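(* Let $f:\Omega\times\mathbb{R}^n\to[0,+\infty)$, $f=f(x,\xi)$, be strictly convex with respect to $\xi$, and let $1<p<q$ be exponents such that $$q\le p\left(\frac{n+1}{n}\right).$$ Assume that there are constants $m,M,K,H>0$ such that $f$ satisfies the following conditions, where (H1)--(H4) are required for almost every $x\in\Omega$ and for every $\xi,\lambda\in\mathbb{R}^n$. (H1) $f(x,\cdot)\in \mathcal{C}^2(\mathbb{R}^n)$. (H2) $m(1+|\xi|^2)^{\frac{p-2}{2}}|\lambda|^2\le\sum_{i,j=1}^n f_{\xi_i\xi_j}(x,\xi)\lambda_i\lambda_j$. (H3) $|f_{\xi\xi}(x,\xi)|\le M(1+|\xi|^2)^{\frac{q-2}{2}}$. (H4) $|f_{\xi x}(x,\xi)|\le K(1+|\xi|^2)^{\frac{q-1}{2}}$. (H5) For every $\varepsilon>0$ and every $x\in\Omega$ such that $B_\varepsilon(x)\Subset\Omega$, there exists $\tilde y=\tilde y(x,\varepsilon)$ such that, with some function $c(\varepsilon)\ge1$, $c(\varepsilon)\to1$ as $\varepsilon\to0$, one has $$f(\tilde y,\xi)\le c(\varepsilon)f(y,\xi)\quad\text{for all }(y,\xi)\in B_\varepsilon(x)\times\mathbb{R}^n.$$ (H6) $|f(x,\xi)-f(y,\xi)|\le H|x-y|(1+|\xi|^2)^{\frac q2}$ for every $x,y\in\Omega$ and every $\xi\in\mathbb{R}^n$. Then, for every ball $B_R\Subset\Omega$, there exists a sequence of functions $f_h:B_R\times\mathbb{R}^n\to[0,+\infty)$, $f_h=f_h(x,\xi)$,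 with $$f_h(x,\xi)=\sum_{i=1}^{N}a_{i,h}(x)\,g_{i,h}(\xi),$$ satisfying (H1)--(H4) with constants $m$, $M$ and $K$ independent of $h$. Moreover, $\xi\mapsto f_h(x,\xi)$ is strictly convex for all $x\in B_R$, and $$f_h(x,\xi)\to f(x,\xi)\quad\text{uniformly in } B_R\times\mathcal{K}$$ for every compact subset $\mathcal{K}$ of $\mathbb{R}^n$. Furthermore, there exists a subsequence $(f_{h_k})$ such that for every $u\in W^{1,p}(B_R)$ such that $x\mapsto f(x,Du(x))\in L^1(B_R)$, $$\lim_{k}\int_{B_R}f_{h_k}(x,Du(x))\,dx=\int_{B_R}f(x,Du(x))\,dx.$$
   Context: $\Omega\subset\mathbb{R}^n$ is a regular bounded open set. $B_r(x)=\{y\in\mathbb{R}^n:|y-x|<r\}$ is the open ball of center $x$ and radius $r$ (the center is omitted when irrelevant, as in $B_R$); $A\Subset\Omega$ means that $\overline A$ is a compact subset of $\Omega$. $f_{\xi_i\xi_j}$ are the second partial derivatives of $f$ in $\xi$, $f_{\xi\xi}$ is the Hessian of $f$ in $\xi$, and $f_{\xi x}$ is the matrix of mixed second derivatives of $f$ in $\xi$ and $x$. In the representation of $f_h$, $N$ is a positive integer, each $a_{i,h}$ is a function of $x$ only and each $g_{i,h}$ is a function of $\xi$ only. For $f_h$, conditions (H1)--(H4) are those above with $f_h$ in place of $f$ and $B_R$ in place of $\Omega$. *)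

theory Defs
  imports "HOL-Analysis.Analysis"
begin

definition compactly_contained :: "(real^'n) set \<Rightarrow> (real^'n) set \<Rightarrow> bool" where
  "compactly_contained A U \<longleftrightarrow> compact (closure A) \<and> closure A \<subseteq> U"

definition strictly_convex :: "(real^'n \<Rightarrow> real) \<Rightarrow> bool" where
  "strictly_convex g \<longleftrightarrow>
     (\<forall>\<xi> \<eta>. \<forall>t\<in>{0<..<1}. \<xi> \<noteq> \<eta> \<longrightarrow>
        g ((1 - t) *\<^sub>R \<xi> + t *\<^sub>R \<eta>) < (1 - t) * g \<xi> + t * g \<eta>)"

definition has_partial :: "'n::finite \<Rightarrow> (real^'n \<Rightarrow> real) \<Rightarrow> real^'n \<Rightarrow> bool" where
  "has_partial i g x \<longleftrightarrow> (\<lambda>t::real. g (x + t *\<^sub>R axis i 1)) field_differentiable (at 0)"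

(* meaningful only where has_partial i g x holds; existence is always demanded separately *)
definition partial :: "'n::finite \<Rightarrow> (real^'n \<Rightarrow> real) \<Rightarrow> real^'n \<Rightarrow> real" where
  "partial i g x = deriv (\<lambda>t::real. g (x + t *\<^sub>R axis i 1)) 0"

definition C2 :: "(real^'n \<Rightarrow> real) \<Rightarrow> bool" where
  "C2 g \<longleftrightarrow> continuous_on UNIV g \<and>
     (\<forall>i. (\<forall>\<xi>. has_partial i g \<xi>) \<and> continuous_on UNIV (partial i g) \<and>
        (\<forall>j. (\<forall>\<xi>. has_partial j (partial i g) \<xi>) \<and>
             continuous_on UNIV (partial j (partial i g))))"

definition hessian_xi ::
  "(real^'n \<Rightarrow> real^'n \<Rightarrow> real) \<Rightarrow> real^'n \<Rightarrow> real^'n \<Rightarrow> real^'n^'n" where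
  "hessian_xi f x \<xi> = (\<chi> i j. partial j (partial i (f x)) \<xi>)"

definition mixed_xi_x ::
  "(real^'n \<Rightarrow> real^'n \<Rightarrow> real) \<Rightarrow> real^'n \<Rightarrow> real^'n \<Rightarrow> real^'n^'n" where
  "mixed_xi_x f x \<xi> = (\<chi> i j. partial j (\<lambda>y. partial i (f y) \<xi>) x)"

(* The xi_i-derivative has to exist along a segment through x in direction e_j
   before it can be differentiated in x_j. *)
definition has_mixed_xi_x ::
  "(real^'n \<Rightarrow> real^'n \<Rightarrow> real) \<Rightarrow> real^'n \<Rightarrow> real^'n \<Rightarrow> bool" where
  "has_mixed_xi_x f x \<xi> \<longleftrightarrow>
     (\<forall>i j. (\<forall>\<^sub>F t::real in nhds 0. has_partial i (f (x + t *\<^sub>R axis j 1)) \<xi>) \<and>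
            has_partial j (\<lambda>y. partial i (f y) \<xi>) x)"

definition H1 :: "(real^'n) set \<Rightarrow> (real^'n \<Rightarrow> real^'n \<Rightarrow> real) \<Rightarrow> bool" where
  "H1 U f \<longleftrightarrow> (AE x\<in>U in lebesgue. C2 (f x))"

definition H2 :: "real \<Rightarrow> real \<Rightarrow> (real^'n) set \<Rightarrow> (real^'n \<Rightarrow> real^'n \<Rightarrow> real) \<Rightarrow> bool" where
  "H2 p m U f \<longleftrightarrow> (AE x\<in>U in lebesgue. \<forall>\<xi> v.
     m * (1 + (norm \<xi>)\<^sup>2) powr ((p - 2) / 2) * (norm v)\<^sup>2
       \<le> (\<Sum>i\<in>UNIV. \<Sum>j\<in>UNIV. hessian_xi f x \<xi> $ i $ j * v $ i * v $ j))"

(* the norm on real^'n^'n is the Euclidean (Frobenius) norm *)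
definition H3 :: "real \<Rightarrow> real \<Rightarrow> (real^'n) set \<Rightarrow> (real^'n \<Rightarrow> real^'n \<Rightarrow> real) \<Rightarrow> bool" where
  "H3 q M U f \<longleftrightarrow> (AE x\<in>U in lebesgue. \<forall>\<xi>.
     norm (hessian_xi f x \<xi>) \<le> M * (1 + (norm \<xi>)\<^sup>2) powr ((q - 2) / 2))"

definition H4 :: "real \<Rightarrow> real \<Rightarrow> (real^'n) set \<Rightarrow> (real^'n \<Rightarrow> real^'n \<Rightarrow> real) \<Rightarrow> bool" where
  "H4 q K U f \<longleftrightarrow> (AE x\<in>U in lebesgue. \<forall>\<xi>. has_mixed_xi_x f x \<xi> \<and>
     norm (mixed_xi_x f x \<xi>) \<le> K * (1 + (norm \<xi>)\<^sup>2) powr ((q - 1) / 2))"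

(* the function c depends on the radius only; the point y' may depend on x and on the radius *)
definition H5 :: "(real^'n) set \<Rightarrow> (real^'n \<Rightarrow> real^'n \<Rightarrow> real) \<Rightarrow> bool" where
  "H5 U f \<longleftrightarrow> (\<exists>c::real \<Rightarrow> real.
     (\<forall>\<epsilon>>0. c \<epsilon> \<ge> 1) \<and> (c \<longlongrightarrow> 1) (at_right 0) \<and>
     (\<forall>\<epsilon>>0. \<forall>x\<in>U. compactly_contained (ball x \<epsilon>) U \<longrightarrow>
        (\<exists>y'\<in>U. \<forall>y\<in>ball x \<epsilon>. \<forall>\<xi>. f y' \<xi> \<le> c \<epsilon> * f y \<xi>)))"

definition H6 :: "real \<Rightarrow> real \<Rightarrow> (real^'n) set \<Rightarrow> (real^'n \<Rightarrow> real^'n \<Rightarrow> real) \<Rightarrow> bool" where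
  "H6 q H U f \<longleftrightarrow> (\<forall>x\<in>U. \<forall>y\<in>U. \<forall>\<xi>.
     \<bar>f x \<xi> - f y \<xi>\<bar> \<le> H * norm (x - y) * (1 + (norm \<xi>)\<^sup>2) powr (q / 2))"

fun iterated_partial :: "'n::finite list \<Rightarrow> (real^'n \<Rightarrow> real) \<Rightarrow> real^'n \<Rightarrow> real" where
  "iterated_partial [] g = g"
| "iterated_partial (i # is) g = partial i (iterated_partial is g)"

definition smooth :: "(real^'n \<Rightarrow> real) \<Rightarrow> bool" where
  "smooth g \<longleftrightarrow> (\<forall>is. continuous_on UNIV (iterated_partial is g) \<and>
     (\<forall>i x. has_partial i (iterated_partial is g) x))"

definition test_function :: "(real^'n) set \<Rightarrow> (real^'n \<Rightarrow> real) \<Rightarrow> bool" where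
  "test_function U \<phi> \<longleftrightarrow> smooth \<phi> \<and> compactly_contained {x. \<phi> x \<noteq> 0} U"

definition in_Lp :: "real \<Rightarrow> (real^'n) set \<Rightarrow> (real^'n \<Rightarrow> 'b::euclidean_space) \<Rightarrow> bool" where
  "in_Lp p U g \<longleftrightarrow> set_borel_measurable lebesgue U g \<and>
     set_integrable lebesgue U (\<lambda>x. norm (g x) powr p)"

(* u lies in W^{1,p}(U), for p >= 1, and Du (unique up to null sets) is its weak gradient *)
definition W1p_with_gradient ::
  "real \<Rightarrow> (real^'n) set \<Rightarrow> (real^'n \<Rightarrow> real) \<Rightarrow> (real^'n \<Rightarrow> real^'n) \<Rightarrow> bool" where
  "W1p_with_gradient p U u Du \<longleftrightarrow> in_Lp p U u \<and> in_Lp p U Du \<and>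
     (\<forall>\<phi> i. test_function U \<phi> \<longrightarrow>
        (LINT x:U|lebesgue. u x * partial i \<phi> x) = - (LINT x:U|lebesgue. Du x $ i * \<phi> x))"

end

theory Submission
  imports Defs
begin

text \<open>With \<open>w(\<xi>) = (1 + |\<xi>|\<^sup>2)\<^bsup>p/2\<^esup>\<close> and \<open>\<kappa>\<close> small, \<open>a = f(x,\<cdot>) - \<kappa> w\<close> is still convex and
  superlinear. Its largest \<open>\<Lambda>\<close>-Lipschitz minorant \<open>b(\<xi>) = inf\<^sub>\<eta> a(\<eta>) + \<Lambda> |\<xi> - \<eta>|\<close> is convex, lies below \<open>a\<close>,
  coincides with \<open>a\<close> on balls that exhaust the space as \<open>\<Lambda>\<close> grows, and inherits the second difference
  bound of \<open>a\<close> with a constant independent of \<open>\<Lambda>\<close>. The infimum is attained in a ball whose radius depends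
  on \<open>\<Lambda>\<close> only, so \<open>b\<close> is Lipschitz in \<open>x\<close> uniformly in \<open>\<xi>\<close>. Hence one may freeze \<open>x\<close> on the pieces
  of a fine partition of the ball, add \<open>\<kappa> w\<close> back and mollify in \<open>\<xi>\<close>. The result is piecewise constant
  in \<open>x\<close>, so its mixed derivatives vanish almost everywhere, and it is at most \<open>f(x,\<xi>) + C w(\<xi>)\<close>; the
  integrals therefore converge by dominated convergence along the whole sequence.\<close>

subsection \<open>Power weights\<close>

text \<open>Freezing x in f itself is not enough: by (H6) the error is of order \<delta> (1 +
  |\<xi>|^2)^(q/2), and |Du|^q need not be integrable when only Du in L^p and f(x, Du) in L^1 are
  known. After the cut to linear growth the error of freezing no longer grows with \<xi>, and
  mollification costs only a small multiple of w(Du), which is integrable. The cut destroys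
  ellipticity, hence the detour through \<kappa> w. Only half of the ellipticity is spent on it: f -
  2 \<kappa> w is still convex, and the other half makes a superlinear. The envelope need not be
  differentiable, so its curvature is measured by symmetric second differences, which commute with
  averaging and return Hessian bounds in the limit. The delicate point is that the upper bound must
  not see \<Lambda>. If the minimiser \<eta> is comparable to \<xi> in size, moving it along with
  \<xi> passes the bound of a on. If it is much smaller, \<Lambda> |\<xi> - \<eta>| <= a(\<xi>) -
  a(\<eta>) bounds \<Lambda>, and the cone is flat far from its vertex.\<close>

definition wt :: "real \<Rightarrow> 'a::real_inner \<Rightarrow> real" where
  "wt s x = (1 + (norm x)\<^sup>2) powr (s / 2)"

text \<open>Replaces the quadratic form of the Hessian for functions that need not be
  differentiable.\<close>

definition sdiff :: "('a::real_vector \<Rightarrow> real) \<Rightarrow> 'a \<Rightarrow> 'a \<Rightarrow> real" where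
  "sdiff g v x = g (x + v) + g (x - v) - 2 * g x"

text \<open>The Hessian of \<open>wt s\<close> at y is s (1 + |y|^2)^((s-2)/2) times the matrix I +
  (s-2) y y^T / (1 + |y|^2), whose eigenvalues lie between 1 and s - 1. Hence the extreme curvature
  constants \<open>wt_lo\<close> and \<open>wt_hi\<close>.\<close>

definition wt_lo :: "real \<Rightarrow> real" where "wt_lo s = s * min 1 (s - 1)"
definition wt_hi :: "real \<Rightarrow> real" where "wt_hi s = s * max 1 (s - 1)"

lemma wt_lo_pos: "1 < s \<Longrightarrow> 0 < wt_lo s" and wt_hi_pos: "1 < s \<Longrightarrow> 0 < wt_hi s"
  by (auto simp: wt_lo_def wt_hi_def min_def max_def)

lemma one_plus_norm_sq_pos: "0 < 1 + (norm x)\<^sup>2"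
  by (simp add: add_pos_nonneg)

lemma wt_pos: "0 < wt s x"
  using one_plus_norm_sq_pos[of x] unfolding wt_def by (simp add: less_imp_neq[symmetric])

lemma wt_ge_1: "0 \<le> s \<Longrightarrow> 1 \<le> wt s x"
  unfolding wt_def by (rule ge_one_powr_ge_zero) auto

lemma wt_add: "wt (s + t) x = wt s x * wt t x"
  unfolding wt_def by (simp add: powr_add add_divide_distrib)

lemma wt_2: "wt 2 x = 1 + (norm x)\<^sup>2"
  using one_plus_norm_sq_pos[of x] by (simp add: wt_def)

lemma wt_mono_exponent: "s \<le> t \<Longrightarrow> wt s x \<le> wt t x"
  unfolding wt_def by (intro powr_mono) auto

lemma norm_powr_le_wt: "0 \<le> s \<Longrightarrow> norm x powr s \<le> wt s x"
proof -
  assume s: "0 \<le> s"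
  have "norm x powr s = ((norm x)\<^sup>2) powr (s / 2)"
    by (cases "x = 0") (auto simp: powr_powr simp flip: powr_numeral)
  also have "\<dots> \<le> wt s x"
    unfolding wt_def using s by (intro powr_mono2) auto
  finally show ?thesis .
qed

lemma norm_le_wt: "1 \<le> s \<Longrightarrow> norm x \<le> wt s x"
  using norm_powr_le_wt[of 1 x] wt_mono_exponent[of 1 s x] by simp

lemma wt_le_norm_powr:
  assumes "0 \<le> s"
  shows "wt s x \<le> 2 powr (s / 2) * (1 + norm x powr s)"
proof -
  define r where "r = max 1 (norm x)"
  have "wt s x \<le> (2 * r\<^sup>2) powr (s / 2)"
    unfolding wt_def
  proof (intro powr_mono2)
    show "1 + (norm x)\<^sup>2 \<le> 2 * r\<^sup>2"
    proof -
      have "(norm x)\<^sup>2 \<le> r\<^sup>2" "1\<^sup>2 \<le> r\<^sup>2"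
        by (intro power_mono; simp add: r_def)+
      then show ?thesis by simp
    qed
  qed (use assms in auto)
  also have "\<dots> = 2 powr (s / 2) * (r\<^sup>2) powr (s / 2)"
    by (simp add: powr_mult)
  also have "(r\<^sup>2) powr (s / 2) = r powr s"
    by (simp add: powr_powr r_def flip: powr_numeral)
  also have "r powr s \<le> 1 + norm x powr s"
    by (auto simp: r_def max_def)
  finally show ?thesis by simp
qed

lemma wt_minus: "wt s x * wt (-s) x = 1"
  using one_plus_norm_sq_pos[of x] by (simp add: wt_def powr_minus)

text \<open>Comparability is asked in both directions because s may be negative, as in
  \<open>wt (p - 2)\<close> for p < 2. A nonnegative exponent uses the first hypothesis, a negative
  one the second, applied to \<open>wt (-s)\<close>.\<close>

lemma wt_comparable:
  assumes "1 + (norm x)\<^sup>2 \<le> L * (1 + (norm y)\<^sup>2)" "1 + (norm y)\<^sup>2 \<le> L * (1 + (norm x)\<^sup>2)"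
  shows "wt s x \<le> L powr (\<bar>s\<bar> / 2) * wt s y"
proof (cases "0 \<le> s")
  case True
  have "wt s x \<le> (L * (1 + (norm y)\<^sup>2)) powr (s / 2)"
    unfolding wt_def using assms True by (intro powr_mono2) auto
  also have "\<dots> = L powr (\<bar>s\<bar> / 2) * wt s y"
    using True unfolding wt_def by (simp add: powr_mult)
  finally show ?thesis .
next
  case False
  have "wt (-s) y \<le> (L * (1 + (norm x)\<^sup>2)) powr (-s / 2)"
    unfolding wt_def using assms False by (intro powr_mono2) auto
  also have "\<dots> = L powr (\<bar>s\<bar> / 2) * wt (-s) x"
    using False unfolding wt_def by (simp add: powr_mult)
  finally have "wt (-s) y * (wt s x * wt s y) \<le> L powr (\<bar>s\<bar> / 2) * wt (-s) x * (wt s x * wt s y)"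
    by (intro mult_right_mono mult_nonneg_nonneg) (auto intro: less_imp_le wt_pos)
  moreover have "wt (-s) y * (wt s x * wt s y) = wt s x"
    and "L powr (\<bar>s\<bar> / 2) * wt (-s) x * (wt s x * wt s y) = L powr (\<bar>s\<bar> / 2) * wt s y"
    using wt_minus[of s x] wt_minus[of s y] by (simp_all add: mult_ac)
  ultimately show ?thesis by linarith
qed

lemma one_plus_norm_sq_shift:
  fixes x y :: "'a::real_inner"
  assumes "norm (x - y) \<le> 1"
  shows "1 + (norm x)\<^sup>2 \<le> 3 * (1 + (norm y)\<^sup>2)"
proof -
  have "norm x \<le> norm y + 1"
    using norm_triangle_sub[of x y] assms by linarith
  then have "(norm x)\<^sup>2 \<le> (norm y + 1)\<^sup>2"
    by (intro power_mono) auto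
  then have "(norm x)\<^sup>2 \<le> (norm y)\<^sup>2 + 2 * norm y + 1"
    by (simp add: power2_eq_square algebra_simps)
  moreover have "2 * norm y \<le> (norm y)\<^sup>2 + 1"
    using zero_le_power2[of "norm y - 1"] by (simp add: power2_eq_square algebra_simps)
  moreover have "0 \<le> (norm y)\<^sup>2" by simp
  ultimately show ?thesis unfolding distrib_left by linarith
qed

lemma wt_shift:
  fixes x y :: "'a::real_inner"
  assumes "norm (x - y) \<le> 1"
  shows "wt s x \<le> 3 powr (\<bar>s\<bar> / 2) * wt s y"
  using assms by (intro wt_comparable one_plus_norm_sq_shift) (auto simp: norm_minus_commute)

lemma continuous_on_wt: "continuous_on A (wt s)"
  unfolding wt_def
  by (intro continuous_intros) (simp add: add_nonneg_eq_0_iff)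

subsection \<open>Derivatives along lines\<close>

definition wt_d2 :: "real \<Rightarrow> 'a::real_inner \<Rightarrow> 'a \<Rightarrow> real" where
  "wt_d2 s v y = s * (wt (s - 2) y * (v \<bullet> v) + (s - 2) * wt (s - 4) y * (y \<bullet> v)\<^sup>2)"

lemma wt_line_deriv:
  "((\<lambda>t. wt s (x + t *\<^sub>R v)) has_real_derivative
     s * wt (s - 2) (x + t *\<^sub>R v) * ((x + t *\<^sub>R v) \<bullet> v)) (at t)"
proof -
  have D: "((\<lambda>t. 1 + x \<bullet> x + 2 * t * (x \<bullet> v) + t\<^sup>2 * (v \<bullet> v)) has_real_derivative
      2 * ((x + t *\<^sub>R v) \<bullet> v)) (at t)"
    by (auto intro!: derivative_eq_intros simp: inner_add_left)
  have eq: "1 + (norm (x + t *\<^sub>R v))\<^sup>2 = 1 + x \<bullet> x + 2 * t * (x \<bullet> v) + t\<^sup>2 * (v \<bullet> v)" for t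
    unfolding power2_norm_eq_inner
    by (simp add: inner_add_left inner_add_right inner_commute power2_eq_square)
  have pos: "0 < 1 + x \<bullet> x + 2 * t * (x \<bullet> v) + t\<^sup>2 * (v \<bullet> v)"
    using one_plus_norm_sq_pos[of "x + t *\<^sub>R v"] unfolding eq .
  show ?thesis
    using DERIV_fun_powr[OF D pos, of "s / 2"] unfolding wt_def eq
    by (simp add: diff_divide_distrib mult.assoc)
qed

lemma wt_line_deriv2:
  "((\<lambda>t. s * wt (s - 2) (x + t *\<^sub>R v) * ((x + t *\<^sub>R v) \<bullet> v)) has_real_derivative
     wt_d2 s v (x + t *\<^sub>R v)) (at t)"
  by (auto intro!: derivative_eq_intros wt_line_deriv
      simp: wt_d2_def inner_add_left algebra_simps power2_eq_square)

lemma wt_d2_bounds: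
  assumes "1 < s"
  shows "wt_lo s * wt (s - 2) y * (norm v)\<^sup>2 \<le> wt_d2 s v y"
    and "wt_d2 s v y \<le> wt_hi s * wt (s - 2) y * (norm v)\<^sup>2"
proof -
  define A where "A = wt (s - 2) y * (norm v)\<^sup>2"
  define B where "B = wt (s - 4) y * (y \<bullet> v)\<^sup>2"
  have "(y \<bullet> v)\<^sup>2 \<le> (1 + (norm y)\<^sup>2) * (norm v)\<^sup>2"
    using Cauchy_Schwarz_ineq[of y v] by (simp add: power2_norm_eq_inner distrib_right add_increasing)
  then have "B \<le> wt (s - 4) y * ((1 + (norm y)\<^sup>2) * (norm v)\<^sup>2)"
    unfolding B_def by (intro mult_left_mono) (auto intro: less_imp_le wt_pos)
  also have "\<dots> = A"
    using wt_add[of "s - 4" 2 y] by (simp add: wt_2 A_def)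
  finally have BA: "B \<le> A" .
  have B0: "0 \<le> B" unfolding B_def using wt_pos[of "s - 4" y] by simp
  have d: "wt_d2 s v y = s * (A + (s - 2) * B)"
    unfolding wt_d2_def A_def B_def by (simp add: power2_norm_eq_inner)
  have lo: "min 1 (s - 1) * A \<le> A + (s - 2) * B"
  proof (cases "s \<le> 2")
    case True
    then have "(s - 2) * A \<le> (s - 2) * B" using BA by (intro mult_left_mono_neg) auto
    then show ?thesis using True by (simp add: min_def algebra_simps)
  next
    case False
    then have "0 \<le> (s - 2) * B" using B0 by simp
    then show ?thesis using False by (simp add: min_def)
  qed
  have hi: "A + (s - 2) * B \<le> max 1 (s - 1) * A"
  proof (cases "s \<le> 2")
    case True
    then have "(s - 2) * B \<le> 0" using B0 by (simp add: mult_nonpos_nonneg)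
    then show ?thesis using True by (simp add: max_def)
  next
    case False
    then have "(s - 2) * B \<le> (s - 2) * A" using BA by (intro mult_left_mono) auto
    then show ?thesis using False by (simp add: max_def algebra_simps)
  qed
  show "wt_lo s * wt (s - 2) y * (norm v)\<^sup>2 \<le> wt_d2 s v y"
    using mult_left_mono[OF lo, of s] assms unfolding d wt_lo_def A_def by (simp add: mult.assoc)
  show "wt_d2 s v y \<le> wt_hi s * wt (s - 2) y * (norm v)\<^sup>2"
    using mult_left_mono[OF hi, of s] assms unfolding d wt_hi_def A_def by (simp add: mult.assoc)
qed

text \<open>Expanding to second order on both sides of 0 cancels the first-order terms and leaves
  one Lagrange remainder from each side.\<close>

lemma sdiff_Taylor:
  fixes \<phi> \<phi>' \<phi>'' :: "real \<Rightarrow> real"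
  assumes 1: "\<And>t. (\<phi> has_real_derivative \<phi>' t) (at t)"
    and 2: "\<And>t. (\<phi>' has_real_derivative \<phi>'' t) (at t)" and "0 < a"
  obtains t u where "0 < t" "t < a" "-a < u" "u < 0"
    "\<phi> a + \<phi> (-a) - 2 * \<phi> 0 = (\<phi>'' t + \<phi>'' u) / 2 * a\<^sup>2"
proof -
  define D where "D = (\<lambda>m::nat. if m = 0 then \<phi> else if m = 1 then \<phi>' else \<phi>'')"
  have D: "(D m has_real_derivative D (Suc m) t) (at t)" if "m < 2" for m t
    using that 1 2 by (auto simp: D_def less_Suc_eq numeral_2_eq_2)
  obtain t where t: "0 < t" "t < a" "\<phi> a = (\<Sum>m<2. D m 0 / fact m * a ^ m) + D 2 t / fact 2 * a ^ 2"
    using Taylor_up[of 2 D \<phi> 0 a 0] D \<open>0 < a\<close> by (auto simp: D_def)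
  obtain u where u: "-a < u" "u < 0"
    "\<phi> (-a) = (\<Sum>m<2. D m 0 / fact m * (-a) ^ m) + D 2 u / fact 2 * (-a) ^ 2"
    using Taylor_down[of 2 D \<phi> "-a" 0 0] D \<open>0 < a\<close> by (auto simp: D_def)
  show thesis
  proof (rule that[OF t(1,2) u(1,2)])
    show "\<phi> a + \<phi> (-a) - 2 * \<phi> 0 = (\<phi>'' t + \<phi>'' u) / 2 * a\<^sup>2"
      unfolding t(3) u(3) by (simp add: D_def numeral_2_eq_2 field_simps)
  qed
qed

text \<open>The Taylor points lie within unit distance of x; the factor
  \<open>3 powr (\<bar>s - 2\<bar> / 2)\<close> is the price of moving the weight from there to
  x.\<close>

lemma sdiff_wt_bounds:
  fixes x v :: "'a::real_inner"
  assumes s: "1 < s" and v: "norm v \<le> 1"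
  shows "wt_lo s / 3 powr (\<bar>s - 2\<bar> / 2) * wt (s - 2) x * (norm v)\<^sup>2 \<le> sdiff (wt s) v x"
    and "sdiff (wt s) v x \<le> wt_hi s * 3 powr (\<bar>s - 2\<bar> / 2) * wt (s - 2) x * (norm v)\<^sup>2"
proof -
  define k where "k = 3 powr (\<bar>s - 2\<bar> / 2)"
  have k: "0 < k" by (simp add: k_def)
  obtain t u where tu: "0 < t" "t < 1" "-1 < u" "u < 0" and
    eq: "sdiff (wt s) v x = (wt_d2 s v (x + t *\<^sub>R v) + wt_d2 s v (x + u *\<^sub>R v)) / 2"
    using sdiff_Taylor[OF wt_line_deriv wt_line_deriv2, of 1 s x v] by (auto simp: sdiff_def)
  have near: "norm (x + r *\<^sub>R v - x) \<le> 1" "norm (x - (x + r *\<^sub>R v)) \<le> 1" if "\<bar>r\<bar> < 1" for r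
    using that v mult_mono[of "\<bar>r\<bar>" 1 "norm v" 1] by auto
  have lo: "wt_lo s / k * wt (s - 2) x * (norm v)\<^sup>2 \<le> wt_d2 s v (x + r *\<^sub>R v)" if "\<bar>r\<bar> < 1" for r
  proof -
    have "wt (s - 2) x / k \<le> wt (s - 2) (x + r *\<^sub>R v)"
      using wt_shift[OF near(2)[OF that], of "s - 2"] k by (simp add: k_def field_simps)
    then have "wt_lo s * (wt (s - 2) x / k) * (norm v)\<^sup>2 \<le> wt_lo s * wt (s - 2) (x + r *\<^sub>R v) * (norm v)\<^sup>2"
      using wt_lo_pos[OF s] by (intro mult_right_mono mult_left_mono) auto
    with wt_d2_bounds(1)[OF s, of "x + r *\<^sub>R v" v] show ?thesis by (simp add: mult_ac)
  qed
  have hi: "wt_d2 s v (x + r *\<^sub>R v) \<le> wt_hi s * k * wt (s - 2) x * (norm v)\<^sup>2" if "\<bar>r\<bar> < 1" for r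
  proof -
    have "wt (s - 2) (x + r *\<^sub>R v) \<le> k * wt (s - 2) x"
      using wt_shift[OF near(1)[OF that], of "s - 2"] k by (simp add: k_def field_simps)
    then have "wt_hi s * wt (s - 2) (x + r *\<^sub>R v) * (norm v)\<^sup>2 \<le> wt_hi s * (k * wt (s - 2) x) * (norm v)\<^sup>2"
      using wt_hi_pos[OF s] by (intro mult_right_mono mult_left_mono) auto
    with wt_d2_bounds(2)[OF s, of v "x + r *\<^sub>R v"] show ?thesis by (simp add: mult_ac)
  qed
  show "wt_lo s / 3 powr (\<bar>s - 2\<bar> / 2) * wt (s - 2) x * (norm v)\<^sup>2 \<le> sdiff (wt s) v x"
    using add_mono[OF lo[of t] lo[of u]] tu unfolding eq k_def[symmetric] by (simp add: field_simps)
  show "sdiff (wt s) v x \<le> wt_hi s * 3 powr (\<bar>s - 2\<bar> / 2) * wt (s - 2) x * (norm v)\<^sup>2"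
    using add_mono[OF hi[of t] hi[of u]] tu unfolding eq k_def[symmetric] by (simp add: field_simps)
qed

text \<open>The increment is small relative to the weight itself: the gradient at the mean value
  point z has norm s |z| \<open>wt (s - 2) z\<close>, at most s \<open>wt s z\<close> since |z| <= 1
  + |z|^2, and the weight is then moved to y.\<close>

lemma wt_gradient_bound:
  fixes x y :: "'a::real_inner"
  assumes s: "1 \<le> s" and xy: "norm (x - y) \<le> 1"
  shows "\<bar>wt s x - wt s y\<bar> \<le> s * 3 powr (s / 2) * wt s y * norm (x - y)"
proof -
  define v where "v = x - y"
  obtain t where t: "0 < t" "t < 1" and
    eq: "wt s x - wt s y = s * wt (s - 2) (y + t *\<^sub>R v) * ((y + t *\<^sub>R v) \<bullet> v)"
    using MVT2[of 0 1 "\<lambda>t. wt s (y + t *\<^sub>R v)", OF _ wt_line_deriv] by (auto simp: v_def)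
  define z where "z = y + t *\<^sub>R v"
  have "norm (z - y) \<le> 1"
    using t xy mult_mono[of t 1 "norm v" 1] by (auto simp: z_def v_def)
  then have sh: "wt s z \<le> 3 powr (s / 2) * wt s y"
    using wt_shift[of z y s] s by simp
  have "wt (s - 2) z * norm z \<le> wt (s - 2) z * wt 2 z"
    by (intro mult_left_mono norm_le_wt) (auto intro: less_imp_le wt_pos)
  also have "\<dots> = wt s z" using wt_add[of "s - 2" 2 z] by simp
  finally have "wt (s - 2) z * norm z \<le> 3 powr (s / 2) * wt s y" using sh by simp
  then have "s * (wt (s - 2) z * norm z) * norm v \<le> s * (3 powr (s / 2) * wt s y) * norm v"
    using s by (intro mult_right_mono mult_left_mono) auto
  moreover have "\<bar>wt s x - wt s y\<bar> \<le> s * (wt (s - 2) z * norm z) * norm v"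
    using mult_left_mono[OF Cauchy_Schwarz_ineq2[of z v], of "s * wt (s - 2) z"] s wt_pos[of "s - 2" z]
    unfolding eq z_def[symmetric] by (simp add: abs_mult mult.assoc)
  ultimately show ?thesis by (simp add: v_def mult.assoc)
qed

lemma convex_on_UNIV_lines:
  fixes g :: "'a::real_vector \<Rightarrow> real"
  assumes "\<And>x v. convex_on UNIV (\<lambda>t. g (x + t *\<^sub>R v))"
  shows "convex_on UNIV g"
proof (rule convex_onI)
  fix t :: real and x y :: 'a
  assume "0 < t" "t < 1"
  then show "g ((1 - t) *\<^sub>R x + t *\<^sub>R y) \<le> (1 - t) * g x + t * g y"
    using convex_onD[OF assms[of x "y - x"], of t 0 1] by (simp add: algebra_simps)
qed simp

lemma convex_on_wt:
  assumes "1 < s"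
  shows "convex_on UNIV (wt s)"
proof (rule convex_on_UNIV_lines)
  fix x v :: 'a
  have "0 \<le> wt_lo s * wt (s - 2) y * (norm v)\<^sup>2" for y :: 'a
    using wt_lo_pos[OF assms] wt_pos[of "s - 2" y] by simp
  then have "0 \<le> wt_d2 s v (x + t *\<^sub>R v)" for t
    using wt_d2_bounds(1)[OF assms] order_trans by blast
  then show "convex_on UNIV (\<lambda>t. wt s (x + t *\<^sub>R v))"
    by (rule f''_ge0_imp_convex[OF convex_UNIV wt_line_deriv wt_line_deriv2])
qed

subsection \<open>Functions with continuous partial derivatives\<close>

lemma has_partialD:
  assumes "has_partial i g x"
  shows "((\<lambda>t. g (x + t *\<^sub>R axis i 1)) has_real_derivative partial i g x) (at 0)"
  using assms unfolding has_partial_def partial_def by (simp add: DERIV_deriv_iff_field_differentiable)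

lemma has_partialI:
  assumes "((\<lambda>t. g (x + t *\<^sub>R axis i 1)) has_real_derivative D) (at 0)"
  shows "has_partial i g x" and "partial i g x = D"
  using assms unfolding has_partial_def partial_def
  by (auto simp: field_differentiable_def intro: DERIV_imp_deriv)

lemma partial_line_deriv:
  assumes "\<And>y. has_partial i g y"
  shows "((\<lambda>t. g (x + t *\<^sub>R axis i 1)) has_real_derivative partial i g (x + t *\<^sub>R axis i 1)) (at t)"
proof -
  have "((\<lambda>r. g ((x + t *\<^sub>R axis i 1) + r *\<^sub>R axis i 1)) has_real_derivative partial i g (x + t *\<^sub>R axis i 1)) (at (t - t))"
    using has_partialD[OF assms[of "x + t *\<^sub>R axis i 1"]] by simp
  moreover have "((\<lambda>r. r - t) has_real_derivative 1) (at t)"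
    by (auto intro!: derivative_eq_intros)
  ultimately have "((\<lambda>r. g ((x + t *\<^sub>R axis i 1) + (r - t) *\<^sub>R axis i 1)) has_real_derivative partial i g (x + t *\<^sub>R axis i 1) * 1) (at t)"
    by (rule DERIV_chain2)
  then show ?thesis by (simp add: algebra_simps)
qed

text \<open>The stations of a walk from 0 to v that changes one coordinate at a time;
  \<open>S\<close> holds the coordinates already changed.\<close>

definition coord_restrict :: "'n set \<Rightarrow> real^'n \<Rightarrow> real^'n" where
  "coord_restrict S v = (\<chi> i. if i \<in> S then v $ i else 0)"

lemma norm_coord_restrict_add_axis_le:
  fixes v :: "real^'n"
  assumes "k \<notin> S" "\<bar>t\<bar> \<le> \<bar>v $ k\<bar>"
  shows "norm (coord_restrict S v + t *\<^sub>R axis k 1) \<le> norm v"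
  using assms by (intro norm_le_componentwise_cart) (auto simp: coord_restrict_def axis_def)

lemma partial_increment_bound:
  fixes g :: "real^'n \<Rightarrow> real"
  assumes part: "\<And>i y. has_partial i g y"
    and close: "\<And>i y. norm (y - x) < d \<Longrightarrow> \<bar>partial i g y - partial i g x\<bar> \<le> e"
    and v: "norm v < d" and "finite S"
  shows "\<bar>g (x + coord_restrict S v) - g x - (\<Sum>i\<in>S. partial i g x * v $ i)\<bar> \<le> e * (\<Sum>i\<in>S. \<bar>v $ i\<bar>)"
  using \<open>finite S\<close>
proof (induction S rule: finite_induct)
  case empty
  then show ?case by (simp add: coord_restrict_def zero_vec_def[symmetric])
next
  case (insert k S)
  define y where "y = x + coord_restrict S v"
  define \<phi> where "\<phi> = (\<lambda>t. g (y + t *\<^sub>R axis k 1) - t * partial k g x)"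
  have ins: "x + coord_restrict (insert k S) v = y + (v $ k) *\<^sub>R axis k 1"
    using insert.hyps by (auto simp: y_def coord_restrict_def vec_eq_iff axis_def)
  have D: "(\<phi> has_real_derivative partial k g (y + t *\<^sub>R axis k 1) - partial k g x) (at t)" for t
    unfolding \<phi>_def by (auto intro!: derivative_eq_intros partial_line_deriv part)
  \<comment> \<open>The segment that adds coordinate k stays in the ball where \<open>close\<close>
    applies, since none of its points is farther from x than |v|. The mean value inequality on this
    segment then gives the induction step.\<close>
  have "\<bar>partial k g (y + t *\<^sub>R axis k 1) - partial k g x\<bar> \<le> e" if "\<bar>t\<bar> \<le> \<bar>v $ k\<bar>" for t
    using norm_coord_restrict_add_axis_le[OF insert.hyps(2) that] v
    by (intro close) (auto simp: y_def algebra_simps)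
  then have "norm (\<phi> (v $ k) - \<phi> 0) \<le> e * norm (v $ k - 0)"
    by (intro field_differentiable_bound[of "cball 0 \<bar>v $ k\<bar>" \<phi> "\<lambda>t. partial k g (y + t *\<^sub>R axis k 1) - partial k g x"]
        DERIV_subset[OF D]) auto
  then have "\<bar>g (y + (v $ k) *\<^sub>R axis k 1) - g y - partial k g x * v $ k\<bar> \<le> e * \<bar>v $ k\<bar>"
    by (simp add: \<phi>_def algebra_simps)
  with insert show ?case unfolding ins by (simp add: y_def algebra_simps)
qed

text \<open>\<open>C2\<close> speaks of coordinate directions only, while convexity has to be tested
  along arbitrary lines; the total derivative bridges the two.\<close>

lemma continuous_partials_imp_has_derivative:
  fixes g :: "real^'n \<Rightarrow> real"
  assumes part: "\<And>i y. has_partial i g y"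
    and cont: "\<And>i. continuous_on UNIV (partial i g)"
  shows "(g has_derivative (\<lambda>v. \<Sum>i\<in>UNIV. partial i g x * v $ i)) (at x)"
  unfolding has_derivative_at_alt
proof (intro conjI allI impI)
  show "bounded_linear (\<lambda>v. \<Sum>i\<in>UNIV. partial i g x * v $ i)"
    by (intro bounded_linear_intros bounded_linear_vec_nth)
  fix e :: real assume "0 < e"
  define e' where "e' = e / real CARD('n)"
  have "0 < e'" using \<open>0 < e\<close> by (simp add: e'_def)
  have "\<forall>i. \<exists>d>0. \<forall>y. norm (y - x) < d \<longrightarrow> \<bar>partial i g y - partial i g x\<bar> \<le> e'"
  proof
    fix i
    have "\<exists>d>0. \<forall>y. dist y x < d \<longrightarrow> dist (partial i g y) (partial i g x) < e'"
      using cont[of i] \<open>0 < e'\<close> unfolding continuous_on_iff by (metis UNIV_I)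
    then show "\<exists>d>0. \<forall>y. norm (y - x) < d \<longrightarrow> \<bar>partial i g y - partial i g x\<bar> \<le> e'"
      unfolding dist_norm by (metis less_imp_le real_norm_def)
  qed
  then obtain d where d: "\<And>i. 0 < d i" "\<And>i y. norm (y - x) < d i \<Longrightarrow> \<bar>partial i g y - partial i g x\<bar> \<le> e'"
    by metis
  define \<delta> where "\<delta> = Min (range d)"
  have "0 < \<delta>" "\<And>i. \<delta> \<le> d i" by (auto simp: \<delta>_def d)
  have "norm (g y - g x - (\<Sum>i\<in>UNIV. partial i g x * (y - x) $ i)) \<le> e * norm (y - x)"
    if "norm (y - x) < \<delta>" for y
  proof -
    have "\<bar>g (x + coord_restrict UNIV (y - x)) - g x - (\<Sum>i\<in>UNIV. partial i g x * (y - x) $ i)\<bar>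
        \<le> e' * (\<Sum>i\<in>UNIV. \<bar>(y - x) $ i\<bar>)"
      using d(2) \<open>\<And>i. \<delta> \<le> d i\<close> that by (intro partial_increment_bound[OF part, where d = \<delta>]) (auto intro: less_le_trans)
    also have "coord_restrict UNIV (y - x) = y - x"
      by (simp add: coord_restrict_def vec_eq_iff)
    finally have "\<bar>g y - g x - (\<Sum>i\<in>UNIV. partial i g x * (y - x) $ i)\<bar> \<le> e' * (\<Sum>i\<in>UNIV. \<bar>(y - x) $ i\<bar>)"
      by simp
    also have "\<dots> \<le> e' * (real CARD('n) * norm (y - x))"
      using \<open>0 < e'\<close> by (intro mult_left_mono sum_bounded_above component_le_norm_cart) auto
    finally show ?thesis
      using \<open>0 < e'\<close> by (simp add: e'_def)
  qed
  with \<open>0 < \<delta>\<close> show "\<exists>d>0. \<forall>y. norm (y - x) < d \<longrightarrow>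
      norm (g y - g x - (\<Sum>i\<in>UNIV. partial i g x * (y - x) $ i)) \<le> e * norm (y - x)"
    by blast
qed

lemma continuous_partials_line_deriv:
  fixes g :: "real^'n \<Rightarrow> real"
  assumes "\<And>i y. has_partial i g y" "\<And>i. continuous_on UNIV (partial i g)"
  shows "((\<lambda>t. g (x + t *\<^sub>R v)) has_real_derivative (\<Sum>i\<in>UNIV. partial i g (x + t *\<^sub>R v) * v $ i)) (at t)"
proof -
  have "((\<lambda>t. x + t *\<^sub>R v) has_derivative (\<lambda>r. r *\<^sub>R v)) (at t)"
    by (auto intro!: derivative_eq_intros)
  from has_derivative_compose[OF this continuous_partials_imp_has_derivative[OF assms]]
  show ?thesis
    unfolding has_field_derivative_def
    by (rule has_derivative_eq_rhs) (simp add: fun_eq_iff sum_distrib_left sum_distrib_right mult_ac)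
qed

section \<open>Hessian forms, second differences and convexity\<close>

definition hess_form :: "(real^'n \<Rightarrow> real) \<Rightarrow> real^'n \<Rightarrow> real^'n \<Rightarrow> real" where
  "hess_form g v x = (\<Sum>i\<in>UNIV. \<Sum>j\<in>UNIV. partial j (partial i g) x * v $ i * v $ j)"

lemma C2_line_deriv:
  fixes g :: "real^'n \<Rightarrow> real"
  assumes "C2 g"
  shows "((\<lambda>t. g (x + t *\<^sub>R v)) has_real_derivative (\<Sum>i\<in>UNIV. partial i g (x + t *\<^sub>R v) * v $ i)) (at t)"
    and "((\<lambda>t. \<Sum>i\<in>UNIV. partial i g (x + t *\<^sub>R v) * v $ i) has_real_derivative hess_form g v (x + t *\<^sub>R v)) (at t)"
proof -
  show "((\<lambda>t. g (x + t *\<^sub>R v)) has_real_derivative (\<Sum>i\<in>UNIV. partial i g (x + t *\<^sub>R v) * v $ i)) (at t)"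
    using assms unfolding C2_def by (intro continuous_partials_line_deriv) auto
  have D: "((\<lambda>t. partial i g (x + t *\<^sub>R v)) has_real_derivative
      (\<Sum>j\<in>UNIV. partial j (partial i g) (x + t *\<^sub>R v) * v $ j)) (at t)" for i
    using assms unfolding C2_def by (intro continuous_partials_line_deriv) auto
  have "((\<lambda>t. partial i g (x + t *\<^sub>R v) * v $ i) has_real_derivative
      (\<Sum>j\<in>UNIV. partial j (partial i g) (x + t *\<^sub>R v) * v $ i * v $ j)) (at t)" for i
    using DERIV_cmult_right[OF D[of i], of "v $ i"]
    by (simp add: sum_distrib_right sum_distrib_left mult_ac)
  then show "((\<lambda>t. \<Sum>i\<in>UNIV. partial i g (x + t *\<^sub>R v) * v $ i) has_real_derivative hess_form g v (x + t *\<^sub>R v)) (at t)"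
    unfolding hess_form_def by (intro DERIV_sum) auto
qed

lemma continuous_hess_form:
  assumes "C2 g"
  shows "continuous_on UNIV (hess_form g v)"
  using assms unfolding hess_form_def C2_def by (intro continuous_intros) auto

lemma sdiff_C2_Taylor:
  fixes g :: "real^'n \<Rightarrow> real"
  assumes "C2 g" "0 < a"
  obtains t u where "\<bar>t\<bar> < a" "\<bar>u\<bar> < a"
    "sdiff g (a *\<^sub>R v) x = (hess_form g v (x + t *\<^sub>R v) + hess_form g v (x + u *\<^sub>R v)) / 2 * a\<^sup>2"
proof -
  obtain t u where "0 < t" "t < a" "-a < u" "u < 0"
    "g (x + a *\<^sub>R v) + g (x + (-a) *\<^sub>R v) - 2 * g (x + 0 *\<^sub>R v) =
      (hess_form g v (x + t *\<^sub>R v) + hess_form g v (x + u *\<^sub>R v)) / 2 * a\<^sup>2"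
    using sdiff_Taylor[OF C2_line_deriv(1)[OF assms(1)] C2_line_deriv(2)[OF assms(1)] assms(2)] by metis
  then show thesis using that[of t u] by (simp add: sdiff_def)
qed

text \<open>Divided by a^2, the Taylor identity is the mean of two values of the Hessian form at
  points x + t v and x + u v with |t|, |u| < a, and the form is continuous.\<close>

lemma hess_form_tendsto:
  fixes g :: "real^'n \<Rightarrow> real"
  assumes g: "C2 g"
  shows "((\<lambda>a. sdiff g (a *\<^sub>R v) x / a\<^sup>2) \<longlongrightarrow> hess_form g v x) (at_right 0)"
proof (rule tendstoI)
  fix e :: real assume "0 < e"
  have "isCont (\<lambda>t. hess_form g v (x + t *\<^sub>R v)) 0"
  proof -
    have "continuous_on UNIV (\<lambda>t. hess_form g v (x + t *\<^sub>R v))"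
      by (rule continuous_on_compose2[OF continuous_hess_form[OF g]]) (auto intro!: continuous_intros)
    then show ?thesis by (simp add: continuous_on_eq_continuous_at)
  qed
  then obtain d where "0 < d" and d: "\<And>t. \<bar>t\<bar> < d \<Longrightarrow> \<bar>hess_form g v (x + t *\<^sub>R v) - hess_form g v x\<bar> < e"
    using \<open>0 < e\<close> unfolding continuous_at_eps_delta by (force simp: dist_real_def)
  have avg: "\<bar>(A + B) / 2 - C\<bar> < e" if "\<bar>A - C\<bar> < e" "\<bar>B - C\<bar> < e" for A B C :: real
    using that by (auto simp: abs_less_iff field_simps)
  have "dist (sdiff g (a *\<^sub>R v) x / a\<^sup>2) (hess_form g v x) < e" if "0 < a" "a < d" for a
  proof -
    obtain t u where tu: "\<bar>t\<bar> < a" "\<bar>u\<bar> < a"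
      "sdiff g (a *\<^sub>R v) x = (hess_form g v (x + t *\<^sub>R v) + hess_form g v (x + u *\<^sub>R v)) / 2 * a\<^sup>2"
      using sdiff_C2_Taylor[OF g \<open>0 < a\<close>] .
    then have eq: "sdiff g (a *\<^sub>R v) x / a\<^sup>2 = (hess_form g v (x + t *\<^sub>R v) + hess_form g v (x + u *\<^sub>R v)) / 2"
      using that by simp
    show ?thesis
      unfolding eq dist_real_def
      by (rule avg[OF d[OF order.strict_trans[OF tu(1) that(2)]] d[OF order.strict_trans[OF tu(2) that(2)]]])
  qed
  then show "\<forall>\<^sub>F a in at_right 0. dist (sdiff g (a *\<^sub>R v) x / a\<^sup>2) (hess_form g v x) < e"
    using \<open>0 < d\<close> unfolding eventually_at_right_field by blast
qed

text \<open>The bounds are homogeneous of degree two in v, so they can be tested on a v with a small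
  and divided by a^2. This turns second difference estimates into (H2) and an upper bound for the
  Hessian.\<close>

lemma hess_form_bounds:
  fixes g :: "real^'n \<Rightarrow> real"
  assumes g: "C2 g"
    and lo: "\<And>v. norm v \<le> 1 \<Longrightarrow> A * (norm v)\<^sup>2 \<le> sdiff g v x"
    and hi: "\<And>v. norm v \<le> 1 \<Longrightarrow> sdiff g v x \<le> B * (norm v)\<^sup>2"
  shows "A * (norm v)\<^sup>2 \<le> hess_form g v x" and "hess_form g v x \<le> B * (norm v)\<^sup>2"
proof -
  have ev: "\<forall>\<^sub>F a in at_right 0. 0 < a \<and> norm (a *\<^sub>R v) \<le> 1"
  proof -
    have "\<forall>\<^sub>F a in at_right 0. a < 1 / (norm v + 1)"
      by (intro order_tendstoD(2)[OF tendsto_ident_at]) (simp add: add_nonneg_pos)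
    then show ?thesis
      using eventually_at_right_less[of 0]
    proof eventually_elim
      case (elim a)
      then have "a * (norm v + 1) < 1" by (simp add: pos_less_divide_eq add_nonneg_pos)
      with elim show ?case by (simp add: algebra_simps)
    qed
  qed
  have "\<forall>\<^sub>F a in at_right 0. A * (norm v)\<^sup>2 \<le> sdiff g (a *\<^sub>R v) x / a\<^sup>2"
    using ev
  proof eventually_elim
    case (elim a)
    then show ?case using lo[OF conjunct2[OF elim]] elim by (simp add: field_simps power_mult_distrib)
  qed
  then show "A * (norm v)\<^sup>2 \<le> hess_form g v x"
    by (intro tendsto_lowerbound[OF hess_form_tendsto[OF g]]) auto
  have "\<forall>\<^sub>F a in at_right 0. sdiff g (a *\<^sub>R v) x / a\<^sup>2 \<le> B * (norm v)\<^sup>2"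
    using ev
  proof eventually_elim
    case (elim a)
    then show ?case using hi[OF conjunct2[OF elim]] elim by (simp add: field_simps power_mult_distrib)
  qed
  then show "hess_form g v x \<le> B * (norm v)\<^sup>2"
    by (intro tendsto_upperbound[OF hess_form_tendsto[OF g]]) auto
qed

lemma sum_mult_axis:
  fixes h :: "'n::finite \<Rightarrow> real"
  shows "(\<Sum>k\<in>UNIV. h k * axis i 1 $ k) = h i"
  by (simp add: axis_def mult_delta_right)

lemma hess_form_alt:
  "hess_form g v x = (\<Sum>k\<in>UNIV. (\<Sum>l\<in>UNIV. partial l (partial k g) x * v $ l) * v $ k)"
  unfolding hess_form_def by (simp add: sum_distrib_right sum_distrib_left mult_ac)

lemma hess_form_axis: "hess_form g (axis i 1) x = partial i (partial i g) x"
  unfolding hess_form_alt sum_mult_axis ..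

lemma hess_form_axis_add:
  "hess_form g (axis i 1 + axis j 1) x =
    partial i (partial i g) x + partial j (partial j g) x + partial j (partial i g) x + partial i (partial j g) x"
  unfolding hess_form_alt vector_add_component distrib_left sum.distrib sum_mult_axis by simp

text \<open>Polarisation: the diagonal entries lie in [0, B], and the value at e_i + e_j lies in
  [0, 2B] and, by symmetry, equals the two diagonal entries plus twice the mixed one. Every entry is
  thus at most B in modulus, and there are n^2 of them.\<close>

lemma norm_hessian_le:
  fixes g :: "real^'n \<Rightarrow> real"
  assumes nn: "\<And>v. 0 \<le> hess_form g v x" and hi: "\<And>v. hess_form g v x \<le> B * (norm v)\<^sup>2"
    and sym: "\<And>i j. partial j (partial i g) x = partial i (partial j g) x"
  shows "norm (\<chi> i j. partial j (partial i g) x) \<le> (real CARD('n))\<^sup>2 * B"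
proof -
  have diag: "0 \<le> partial i (partial i g) x" "partial i (partial i g) x \<le> B" for i
    using nn[of "axis i 1"] hi[of "axis i 1"] by (auto simp: hess_form_axis)
  have entry: "\<bar>partial j (partial i g) x\<bar> \<le> B" for i j
  proof (cases "i = j")
    case True
    then show ?thesis using diag by auto
  next
    case False
    have "(norm (axis i 1 + axis j 1 :: real^'n))\<^sup>2 = 2"
      using False unfolding power2_norm_eq_inner by (simp add: inner_add_left inner_add_right inner_axis_axis)
    then show ?thesis
      using nn[of "axis i 1 + axis j 1"] hi[of "axis i 1 + axis j 1"] diag[of i] diag[of j] sym[of i j]
      unfolding hess_form_axis_add by (auto simp: abs_le_iff)
  qed
  have "norm (\<chi> i j. partial j (partial i g) x) \<le> (\<Sum>i\<in>UNIV. norm ((\<chi> i j. partial j (partial i g) x) $ i))"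
    unfolding norm_vec_def by (intro L2_set_le_sum) auto
  also have "\<dots> \<le> (\<Sum>i\<in>(UNIV::'n set). \<Sum>j\<in>(UNIV::'n set). \<bar>partial j (partial i g) x\<bar>)"
  proof (intro sum_mono)
    fix i
    show "norm ((\<chi> i j. partial j (partial i g) x) $ i) \<le> (\<Sum>j\<in>UNIV. \<bar>partial j (partial i g) x\<bar>)"
      using norm_le_l1_cart[of "(\<chi> i j. partial j (partial i g) x) $ i"] by simp
  qed
  also have "\<dots> \<le> (\<Sum>i\<in>(UNIV::'n set). \<Sum>j\<in>(UNIV::'n set). B)"
    by (intro sum_mono entry)
  finally show ?thesis by (simp add: power2_eq_square)
qed

text \<open>The slope along the segment is strictly increasing, so the mean slopes before and after
  the intermediate point are strictly ordered.\<close>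

lemma strictly_convexI_hess_form:
  assumes g: "C2 g" and pos: "\<And>x v. v \<noteq> 0 \<Longrightarrow> 0 < hess_form g v x"
  shows "strictly_convex g"
  unfolding strictly_convex_def
proof (intro allI ballI impI)
  fix x y :: "real^'a" and t :: real
  assume t: "t \<in> {0<..<1}" and "x \<noteq> y"
  define v where "v = y - x"
  define \<phi> where "\<phi> = (\<lambda>t. g (x + t *\<^sub>R v))"
  define \<phi>' where "\<phi>' = (\<lambda>t. \<Sum>i\<in>UNIV. partial i g (x + t *\<^sub>R v) * v $ i)"
  have D: "(\<phi> has_real_derivative \<phi>' t) (at t)" for t
    unfolding \<phi>_def \<phi>'_def by (rule C2_line_deriv(1)[OF g])
  have mono: "\<phi>' r < \<phi>' s" if "r < s" for r s
    using that
  proof (rule DERIV_pos_imp_increasing)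
    fix z
    show "\<exists>l. (\<phi>' has_real_derivative l) (at z) \<and> 0 < l"
      using \<open>x \<noteq> y\<close> unfolding \<phi>'_def
      by (intro exI[of _ "hess_form g v (x + z *\<^sub>R v)"] conjI C2_line_deriv(2)[OF g] pos) (simp add: v_def)
  qed
  obtain r where r: "0 < r" "r < t" "\<phi> t - \<phi> 0 = (t - 0) * \<phi>' r"
    using MVT2[of 0 t \<phi> \<phi>'] t D by auto
  obtain s where s: "t < s" "s < 1" "\<phi> 1 - \<phi> t = (1 - t) * \<phi>' s"
    using MVT2[of t 1 \<phi> \<phi>'] t D by auto
  have "t * (1 - t) * \<phi>' r < t * (1 - t) * \<phi>' s"
    using t r s by (intro mult_strict_left_mono mono) auto
  then have "(1 - t) * (\<phi> t - \<phi> 0) < t * (\<phi> 1 - \<phi> t)"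
    unfolding r(3) s(3) by (simp add: mult_ac)
  then have "\<phi> t < (1 - t) * \<phi> 0 + t * \<phi> 1" by (simp add: algebra_simps)
  then show "g ((1 - t) *\<^sub>R x + t *\<^sub>R y) < (1 - t) * g x + t * g y"
    by (simp add: \<phi>_def v_def algebra_simps)
qed

lemma sdiff_nonneg:
  assumes "convex_on UNIV g"
  shows "0 \<le> sdiff g v x"
proof -
  have "g ((1 - 1/2) *\<^sub>R (x + v) + (1/2) *\<^sub>R (x - v)) \<le> (1 - 1/2) * g (x + v) + 1/2 * g (x - v)"
    by (rule convex_onD[OF assms]) auto
  moreover have "(1 - 1/2) *\<^sub>R (x + v) + (1/2) *\<^sub>R (x - v) = x"
    by (simp add: algebra_simps flip: scaleR_add_left)
  ultimately show ?thesis by (simp add: sdiff_def field_simps)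
qed

text \<open>The quantitative ellipticity and growth of the Hessian, stated as convexity of the
  differences with the model weights; in this form they pass to pointwise limits.\<close>

lemma convex_on_minus_wt:
  fixes g :: "real^'n \<Rightarrow> real"
  assumes g: "C2 g" and s: "1 < s" and "0 \<le> c"
    and ell: "\<And>x v. c * wt_hi s * wt (s - 2) x * (norm v)\<^sup>2 \<le> hess_form g v x"
  shows "convex_on UNIV (\<lambda>x. g x - c * wt s x)"
proof (rule convex_on_UNIV_lines)
  fix x v :: "real^'n"
  show "convex_on UNIV (\<lambda>t. g (x + t *\<^sub>R v) - c * wt s (x + t *\<^sub>R v))"
  proof (rule f''_ge0_imp_convex[OF convex_UNIV])
    fix t :: real
    show "((\<lambda>t. g (x + t *\<^sub>R v) - c * wt s (x + t *\<^sub>R v)) has_real_derivative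
      (\<Sum>i\<in>UNIV. partial i g (x + t *\<^sub>R v) * v $ i) - c * (s * wt (s - 2) (x + t *\<^sub>R v) * ((x + t *\<^sub>R v) \<bullet> v))) (at t)"
      by (intro DERIV_diff DERIV_cmult C2_line_deriv[OF g] wt_line_deriv)
    show "((\<lambda>t. (\<Sum>i\<in>UNIV. partial i g (x + t *\<^sub>R v) * v $ i) - c * (s * wt (s - 2) (x + t *\<^sub>R v) * ((x + t *\<^sub>R v) \<bullet> v)))
      has_real_derivative hess_form g v (x + t *\<^sub>R v) - c * wt_d2 s v (x + t *\<^sub>R v)) (at t)"
      by (intro DERIV_diff DERIV_cmult C2_line_deriv[OF g] wt_line_deriv2)
    show "0 \<le> hess_form g v (x + t *\<^sub>R v) - c * wt_d2 s v (x + t *\<^sub>R v)"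
      using mult_left_mono[OF wt_d2_bounds(2)[OF s, of v "x + t *\<^sub>R v"] \<open>0 \<le> c\<close>] ell[of "x + t *\<^sub>R v" v]
      by (simp add: mult.assoc)
  qed
qed

text \<open>Now the weight has to be the more curved function, so its least curvature
  \<open>wt_lo\<close> enters where the companion statement has \<open>wt_hi\<close>.\<close>

lemma convex_on_wt_minus:
  fixes g :: "real^'n \<Rightarrow> real"
  assumes g: "C2 g" and s: "1 < s" and "0 \<le> c"
    and grow: "\<And>x v. hess_form g v x \<le> c * wt_lo s * wt (s - 2) x * (norm v)\<^sup>2"
  shows "convex_on UNIV (\<lambda>x. c * wt s x - g x)"
proof (rule convex_on_UNIV_lines)
  fix x v :: "real^'n"
  show "convex_on UNIV (\<lambda>t. c * wt s (x + t *\<^sub>R v) - g (x + t *\<^sub>R v))"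
  proof (rule f''_ge0_imp_convex[OF convex_UNIV])
    fix t :: real
    show "((\<lambda>t. c * wt s (x + t *\<^sub>R v) - g (x + t *\<^sub>R v)) has_real_derivative
      c * (s * wt (s - 2) (x + t *\<^sub>R v) * ((x + t *\<^sub>R v) \<bullet> v)) - (\<Sum>i\<in>UNIV. partial i g (x + t *\<^sub>R v) * v $ i)) (at t)"
      by (intro DERIV_diff DERIV_cmult C2_line_deriv[OF g] wt_line_deriv)
    show "((\<lambda>t. c * (s * wt (s - 2) (x + t *\<^sub>R v) * ((x + t *\<^sub>R v) \<bullet> v)) - (\<Sum>i\<in>UNIV. partial i g (x + t *\<^sub>R v) * v $ i))
      has_real_derivative c * wt_d2 s v (x + t *\<^sub>R v) - hess_form g v (x + t *\<^sub>R v)) (at t)"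
      by (intro DERIV_diff DERIV_cmult C2_line_deriv[OF g] wt_line_deriv2)
    show "0 \<le> c * wt_d2 s v (x + t *\<^sub>R v) - hess_form g v (x + t *\<^sub>R v)"
      using mult_left_mono[OF wt_d2_bounds(1)[OF s, of "x + t *\<^sub>R v" v] \<open>0 \<le> c\<close>] grow[of v "x + t *\<^sub>R v"]
      by (simp add: mult.assoc)
  qed
qed

text \<open>The Frobenius norm dominates the operator norm, by Cauchy-Schwarz in each row.\<close>

lemma hess_form_le_norm_hessian:
  fixes g :: "real^'n \<Rightarrow> real"
  shows "hess_form g v x \<le> norm (\<chi> i j. partial j (partial i g) x) * (norm v)\<^sup>2"
proof -
  define A where "A = (\<chi> i j. partial j (partial i g) x)"
  have "hess_form g v x = v \<bullet> (A *v v)"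
    by (simp add: hess_form_def A_def inner_vec_def matrix_vector_mult_def sum_distrib_left mult_ac)
  also have "\<dots> \<le> norm v * norm (A *v v)" by (rule norm_cauchy_schwarz)
  also have "\<dots> \<le> norm v * (norm A * norm v)"
  proof (rule mult_left_mono)
    have "norm (A *v v) \<le> L2_set (\<lambda>i. norm (A $ i) * norm v) UNIV"
      unfolding norm_vec_def[of "A *v v"]
      by (intro L2_set_mono) (auto simp: matrix_vector_mul_component Cauchy_Schwarz_ineq2)
    also have "\<dots> = norm A * norm v"
      unfolding norm_vec_def[of A] by (simp add: L2_set_left_distrib)
    finally show "norm (A *v v) \<le> norm A * norm v" .
  qed simp
  finally show ?thesis by (simp add: A_def power2_eq_square mult_ac)
qed

subsection \<open>Lipschitz envelopes of convex functions\<close>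

text \<open>The inf-convolution of \<open>a\<close> with \<open>L\<close> times the norm
  (Pasch-Hausdorff envelope). A real \<open>INF\<close> is meaningful only for sets bounded below;
  for the functions considered here the infimum is shown to be attained.\<close>

definition envelope :: "real \<Rightarrow> ('a::real_normed_vector \<Rightarrow> real) \<Rightarrow> 'a \<Rightarrow> real" where
  "envelope L a x = (INF y. a y + L * norm (x - y))"

text \<open>Solves k |y|^p <= (A + B) |y| for |y|; the right side dominates A + B |y| once |y| >= 1,
  and the maximum with 1 covers the other y.\<close>

definition coercive_radius :: "real \<Rightarrow> real \<Rightarrow> real \<Rightarrow> real \<Rightarrow> real" where
  "coercive_radius p k A B = max 1 (((A + B) / k) powr (1 / (p - 1)))"

lemma norm_le_coercive_radius:
  assumes "1 < p" "0 < k" "0 \<le> A" "0 \<le> B" and le: "k * wt p y \<le> A + B * norm y"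
  shows "norm y \<le> coercive_radius p k A B"
proof (cases "norm y \<le> 1")
  case True
  then show ?thesis by (simp add: coercive_radius_def)
next
  case False
  have "k * norm y powr p \<le> A + B * norm y"
    using mult_left_mono[OF norm_powr_le_wt[of p y], of k] assms by linarith
  also have "\<dots> \<le> (A + B) * norm y"
    using False \<open>0 \<le> A\<close> mult_left_mono[of 1 "norm y" A] by (simp add: algebra_simps)
  also have "k * norm y powr p = k * norm y powr (p - 1) * norm y"
    using False by (simp add: powr_diff)
  finally have "k * norm y powr (p - 1) \<le> A + B"
    by (rule mult_right_le_imp_le) (use False in linarith)
  then have "norm y powr (p - 1) \<le> (A + B) / k"
    using \<open>0 < k\<close> by (simp add: field_simps)
  then have "(norm y powr (p - 1)) powr (1 / (p - 1)) \<le> ((A + B) / k) powr (1 / (p - 1))"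
    using \<open>1 < p\<close> by (intro powr_mono2) auto
  then show ?thesis
    using False \<open>1 < p\<close> by (simp add: powr_powr coercive_radius_def)
qed

text \<open>By the parallelogram law, the square of the left side is at most 4 (|z|^2 + |v|^2), and
  the square of the right side exceeds this. It quantifies how flat a cone is at distance |z| from
  its vertex.\<close>

lemma norm_second_difference_le:
  fixes z v :: "'a::real_inner"
  assumes "z \<noteq> 0"
  shows "norm (z + v) + norm (z - v) \<le> 2 * norm z + (norm v)\<^sup>2 / norm z"
proof (rule power2_le_imp_le)
  have "(norm (z + v) + norm (z - v))\<^sup>2 \<le> 2 * ((norm (z + v))\<^sup>2 + (norm (z - v))\<^sup>2)"
    using zero_le_power2[of "norm (z + v) - norm (z - v)"] by (simp add: power2_eq_square algebra_simps)
  also have "\<dots> = 4 * ((norm z)\<^sup>2 + (norm v)\<^sup>2)"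
    unfolding power2_norm_eq_inner by (simp add: algebra_simps inner_commute)
  also have "\<dots> \<le> (2 * norm z + (norm v)\<^sup>2 / norm z)\<^sup>2"
    using assms by (simp add: power2_sum power_mult_distrib)
  finally show "(norm (z + v) + norm (z - v))\<^sup>2 \<le> (2 * norm z + (norm v)\<^sup>2 / norm z)\<^sup>2" .
qed simp

text \<open>The point is the nearest point projection of y onto the closed ball of radius |x| about
  0. That ball contains x, so the distance to x does not grow.\<close>

lemma norm_diff_radial_le:
  fixes x y :: "'a::real_inner"
  assumes "norm x < norm y"
  shows "norm (x - (norm x / norm y) *\<^sub>R y) \<le> norm (x - y)"
proof (rule power2_le_imp_le)
  define s where "s = norm x / norm y"
  have y: "0 < norm y" using assms norm_ge_zero[of x] by linarith
  have s: "0 \<le> s" "s < 1" "norm x = s * norm y" using assms y by (auto simp: s_def)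
  have "x \<bullet> y \<le> norm x * norm y" by (rule norm_cauchy_schwarz)
  also have "\<dots> = s * (norm y)\<^sup>2" using s by (simp add: power2_eq_square)
  finally have xy: "x \<bullet> y \<le> s * (norm y)\<^sup>2" .
  have "2 * s * (norm y)\<^sup>2 \<le> (1 + s) * (norm y)\<^sup>2"
    using s by (intro mult_right_mono) auto
  with xy have "0 \<le> (1 - s) * ((1 + s) * (norm y)\<^sup>2 - 2 * (x \<bullet> y))"
    using s by (intro mult_nonneg_nonneg) auto
  also have "\<dots> = (norm (x - y))\<^sup>2 - (norm (x - s *\<^sub>R y))\<^sup>2"
    unfolding power2_norm_eq_inner by (simp add: algebra_simps inner_commute power2_eq_square)
  finally show "(norm (x - (norm x / norm y) *\<^sub>R y))\<^sup>2 \<le> (norm (x - y))\<^sup>2"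
    unfolding s_def by simp
qed simp

text \<open>Models \<open>\<lambda>\<xi>. f x \<xi> - k * wt p \<xi>\<close> for one fixed x. All
  constants defined in this locale are expressions in p, q, k, C0, C1 and not in \<open>a\<close>,
  so they are the same for every x; this is the source of all uniformity in x.\<close>

locale coercive_convex =
  fixes a :: "'a::euclidean_space \<Rightarrow> real" and p q k C0 C1 :: real
  assumes p: "1 < p" and q: "1 < q" and k: "0 < k" and C0: "0 \<le> C0" and C1: "0 \<le> C1"
    and convex: "convex_on UNIV a"
    and coercive: "k * wt p y - C0 * (1 + norm y) \<le> a y"
    and upper: "a y \<le> C0 * wt q y"
    and semiconcave: "convex_on UNIV (\<lambda>y. C1 * wt q y - a y)"
begin

definition lower :: real where "lower = C0 * (1 + coercive_radius p k C0 C0)"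

text \<open>Bounds every y whose value a(y) + L |x - y| does not exceed the bound C0 + L |x| for the
  value at 0. Since |x - y| >= |x| - |y|, the point x drops out.\<close>

definition min_radius :: "real \<Rightarrow> real" where
  "min_radius L = coercive_radius p k (2 * C0) (C0 + L)"

lemma lower_nonneg: "0 \<le> lower"
  using C0 by (simp add: lower_def coercive_radius_def)

text \<open>Where \<open>a\<close> is nonpositive, coercivity confines y to a ball, and there the
  linear term is at most \<open>lower\<close>.\<close>

lemma lower_bound: "- lower \<le> a y"
proof (cases "a y \<le> 0")
  case True
  then have "k * wt p y \<le> C0 + C0 * norm y"
    using coercive[of y] by (simp add: algebra_simps)
  then have "norm y \<le> coercive_radius p k C0 C0"
    by (intro norm_le_coercive_radius p k C0)
  then have "C0 * (1 + norm y) \<le> lower"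
    unfolding lower_def by (intro mult_left_mono add_left_mono C0)
  then show ?thesis
    using coercive[of y] k wt_pos[of p y] by (smt (verit) mult_pos_pos)
qed (use lower_nonneg in auto)

lemma at_0: "a 0 \<le> C0"
  using upper[of 0] by (simp add: wt_def)

lemma continuous: "continuous_on S a"
  using convex_on_continuous[OF open_UNIV convex] continuous_on_subset by blast

lemma envelope_attained:
  assumes "0 \<le> L"
  obtains y where "norm y \<le> min_radius L" "envelope L a x = a y + L * norm (x - y)"
    "\<And>z. a y + L * norm (x - y) \<le> a z + L * norm (x - z)"
proof -
  define \<phi> where "\<phi> = (\<lambda>y. a y + L * norm (x - y))"
  have "compact (cball (0::'a) (min_radius L))" "(0::'a) \<in> cball 0 (min_radius L)"
    by (auto simp: min_radius_def coercive_radius_def)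
  then obtain y where y: "y \<in> cball 0 (min_radius L)" "\<And>z. z \<in> cball 0 (min_radius L) \<Longrightarrow> \<phi> y \<le> \<phi> z"
    using continuous_attains_inf[of "cball 0 (min_radius L)" \<phi>] continuous
    unfolding \<phi>_def by (force intro!: continuous_intros)
  have min: "\<phi> y \<le> \<phi> z" for z
  \<comment> \<open>The minimum over the ball is global: outside, the coercive bound makes the
    functional exceed its value at 0, and 0 lies in the ball.\<close>
  proof (cases "z \<in> cball 0 (min_radius L)")
    case False
    then have "\<not> k * wt p z \<le> 2 * C0 + (C0 + L) * norm z"
      using norm_le_coercive_radius[of p k "2 * C0" "C0 + L" z] p k C0 assms by (auto simp: min_radius_def)
    then have "C0 + L * norm z < k * wt p z - C0 * (1 + norm z)" by (simp add: algebra_simps)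
    moreover have "L * (norm x - norm z) \<le> L * norm (x - z)"
      using assms by (intro mult_left_mono norm_triangle_ineq2) auto
    ultimately have "\<phi> 0 \<le> \<phi> z"
      using coercive[of z] at_0 by (simp add: \<phi>_def algebra_simps)
    with y(2)[of 0] \<open>0 \<in> cball 0 (min_radius L)\<close> show ?thesis by linarith
  qed (use y in auto)
  show thesis
  proof (rule that)
    show "norm y \<le> min_radius L" using y by simp
    show "envelope L a x = a y + L * norm (x - y)"
      unfolding envelope_def using min unfolding \<phi>_def by (intro cInf_eq_minimum) auto
    show "a y + L * norm (x - y) \<le> a z + L * norm (x - z)" for z
      using min[of z] by (simp add: \<phi>_def)
  qed
qed

lemma envelope_le: "0 \<le> L \<Longrightarrow> envelope L a x \<le> a y + L * norm (x - y)"
  using envelope_attained by metis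

lemma envelope_le_self: "0 \<le> L \<Longrightarrow> envelope L a x \<le> a x"
  using envelope_le[of L x x] by simp

lemma envelope_ge: "0 \<le> L \<Longrightarrow> - lower \<le> envelope L a x"
proof -
  assume L: "0 \<le> L"
  obtain y where "envelope L a x = a y + L * norm (x - y)"
    using envelope_attained[OF L] by metis
  then show ?thesis using lower_bound[of y] L by (smt (verit) mult_nonneg_nonneg norm_ge_zero)
qed

lemma envelope_Lipschitz:
  assumes "0 \<le> L"
  shows "\<bar>envelope L a x - envelope L a x'\<bar> \<le> L * norm (x - x')"
proof -
  have "envelope L a u - envelope L a v \<le> L * norm (u - v)" for u v
  proof -
    obtain y where y: "envelope L a v = a y + L * norm (v - y)"
      using envelope_attained[OF assms] by metis
    have "L * norm (u - y) \<le> L * (norm (u - v) + norm (v - y))"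
      using assms norm_triangle_ineq[of "u - v" "v - y"] by (intro mult_left_mono) auto
    then show ?thesis
      using envelope_le[OF assms, of u y] y by (simp add: algebra_simps)
  qed
  from this[of x x'] this[of x' x] show ?thesis by (simp add: norm_minus_commute)
qed

text \<open>Partial minimisation of (x, y) |-> a(y) + L |x - y|, which is jointly convex: combine
  the minimisers of the two endpoints.\<close>

lemma convex_on_envelope:
  assumes "0 \<le> L"
  shows "convex_on UNIV (envelope L a)"
proof (rule convex_onI)
  fix t :: real and u v :: 'a
  assume t: "0 < t" "t < 1"
  obtain y z where y: "envelope L a u = a y + L * norm (u - y)" and z: "envelope L a v = a z + L * norm (v - z)"
    using envelope_attained[OF assms] by metis
  have "envelope L a ((1 - t) *\<^sub>R u + t *\<^sub>R v) \<le> a ((1 - t) *\<^sub>R y + t *\<^sub>R z)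
      + L * norm ((1 - t) *\<^sub>R u + t *\<^sub>R v - ((1 - t) *\<^sub>R y + t *\<^sub>R z))"
    by (rule envelope_le[OF assms])
  also have "a ((1 - t) *\<^sub>R y + t *\<^sub>R z) \<le> (1 - t) * a y + t * a z"
    using t by (intro convex_onD[OF convex]) auto
  also have "(1 - t) *\<^sub>R u + t *\<^sub>R v - ((1 - t) *\<^sub>R y + t *\<^sub>R z) = (1 - t) *\<^sub>R (u - y) + t *\<^sub>R (v - z)"
    by (simp add: algebra_simps)
  also have "L * norm ((1 - t) *\<^sub>R (u - y) + t *\<^sub>R (v - z)) \<le> L * ((1 - t) * norm (u - y) + t * norm (v - z))"
    using t assms norm_triangle_ineq[of "(1 - t) *\<^sub>R (u - y)" "t *\<^sub>R (v - z)"]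
    by (intro mult_left_mono) auto
  finally show "envelope L a ((1 - t) *\<^sub>R u + t *\<^sub>R v) \<le> (1 - t) * envelope L a u + t * envelope L a v"
    unfolding y z by (simp add: algebra_simps)
qed simp

text \<open>If y is longer than x, its projection s y is no farther from x, so minimality gives a(y)
  <= a(s y). Convexity then forces a(y) <= a(0), and coercivity alone bounds y. The resulting radius
  does not involve \<open>L\<close>.\<close>

lemma envelope_minimizer_norm_le:
  assumes L: "0 \<le> L" and min: "\<And>z. a y + L * norm (x - y) \<le> a z + L * norm (x - z)"
  shows "norm y \<le> max (norm x) (min_radius 0)"
proof (cases "norm x < norm y")
  case True
  define s where "s = norm x / norm y"
  have s: "0 \<le> s" "s < 1" using True norm_ge_zero[of x] by (auto simp: s_def divide_less_eq)
  have "L * norm (x - s *\<^sub>R y) \<le> L * norm (x - y)"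
    unfolding s_def by (intro mult_left_mono norm_diff_radial_le True L)
  then have "a y \<le> a (s *\<^sub>R y)" using min[of "s *\<^sub>R y"] by linarith
  also have "\<dots> \<le> (1 - s) * a 0 + s * a y"
    using convex_onD[OF convex, of s 0 y] s by simp
  finally have "(1 - s) * a y \<le> (1 - s) * a 0" by (simp add: algebra_simps)
  then have "a y \<le> a 0" using s by simp
  then have "k * wt p y \<le> 2 * C0 + (C0 + 0) * norm y"
    using coercive[of y] at_0 by (simp add: algebra_simps)
  then have "norm y \<le> min_radius 0"
    unfolding min_radius_def using C0 by (intro norm_le_coercive_radius p k) auto
  then show ?thesis by simp
qed auto

text \<open>One summand for each position of the minimiser: the first when it is comparable to the
  point, the second when it is much shorter. \<open>L\<close> does not occur.\<close>

definition sdiff_const :: real where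
  "sdiff_const = C1 * (wt_hi q * 3 powr (\<bar>q - 2\<bar> / 2)) * (4 + (min_radius 0)\<^sup>2) powr (\<bar>q - 2\<bar> / 2) + 8 * (C0 + lower)"

text \<open>Competitors at x + v and x - v bound the envelope from above there, while its value at x
  is known through the minimiser y. The right competitors depend on whether y is much shorter than
  x.\<close>

lemma sdiff_envelope_le:
  assumes L: "0 \<le> L" and v: "norm v \<le> 1"
  shows "sdiff (envelope L a) v x \<le> sdiff_const * wt (q - 2) x * (norm v)\<^sup>2"
proof -
  obtain y where y: "envelope L a x = a y + L * norm (x - y)"
    and min: "\<And>z. a y + L * norm (x - y) \<le> a z + L * norm (x - z)"
    using envelope_attained[OF L] by metis
  define A where "A = C1 * (wt_hi q * 3 powr (\<bar>q - 2\<bar> / 2)) * (4 + (min_radius 0)\<^sup>2) powr (\<bar>q - 2\<bar> / 2)"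
  have A: "0 \<le> A" using C1 wt_hi_pos[OF q] by (simp add: A_def)
  have w: "0 \<le> wt (q - 2) x * (norm v)\<^sup>2"
    using wt_pos[of "q - 2" x] by simp
  consider "1 \<le> norm x" "norm y < norm x / 2" | "norm x < 1 \<or> norm x / 2 \<le> norm y"
    by linarith
  then show ?thesis
  proof cases
    case 1
    define z where "z = x - y"
    have nz: "norm x / 2 \<le> norm z" using 1 norm_triangle_ineq2[of x y] by (simp add: z_def)
    then have z0: "z \<noteq> 0" "0 < norm z" using 1 by auto
    \<comment> \<open>Comparing y with the competitor x trades \<open>L\<close> for the growth of
      \<open>a\<close>. Since |z| >= |x| / 2 and |x| >= 1, 1 + |x|^2 <= 8 |z|^2, which reduces the
      weight from exponent q to q - 2.\<close>
    have "L * norm z \<le> a x - a y" using min[of x] by (simp add: z_def)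
    also have "\<dots> \<le> C0 * wt q x + lower" using upper[of x] lower_bound[of y] by linarith
    also have "\<dots> \<le> (C0 + lower) * wt q x"
      using mult_left_mono[OF wt_ge_1[of q x] lower_nonneg] q by (simp add: algebra_simps)
    also have "wt q x = wt (q - 2) x * (1 + (norm x)\<^sup>2)"
      using wt_add[of "q - 2" 2 x] by (simp add: wt_2)
    also have "(C0 + lower) * (wt (q - 2) x * (1 + (norm x)\<^sup>2)) \<le> (C0 + lower) * (wt (q - 2) x * (8 * (norm z)\<^sup>2))"
    proof (intro mult_left_mono)
      have "(norm x / 2)\<^sup>2 \<le> (norm z)\<^sup>2" "1\<^sup>2 \<le> (norm x)\<^sup>2" using nz 1 by (intro power_mono; simp)+
      then show "1 + (norm x)\<^sup>2 \<le> 8 * (norm z)\<^sup>2" by (simp add: power_divide)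
    qed (use C0 lower_nonneg wt_pos[of "q - 2" x] in auto)
    finally have Lz: "L * norm z \<le> 8 * (C0 + lower) * wt (q - 2) x * (norm z)\<^sup>2"
      by (simp add: algebra_simps)
    have "L / norm z = L * norm z / (norm z)\<^sup>2" by (simp add: power2_eq_square)
    also have "\<dots> \<le> 8 * (C0 + lower) * wt (q - 2) x"
      by (subst pos_divide_le_eq) (use z0 in simp, rule Lz)
    finally have Lz: "L / norm z \<le> 8 * (C0 + lower) * wt (q - 2) x" .
    \<comment> \<open>Keeping y as competitor for both points cancels a(y); only the second
      difference of the cone remains.\<close>
    have "sdiff (envelope L a) v x \<le> (a y + L * norm (x + v - y)) + (a y + L * norm (x - v - y)) - 2 * (a y + L * norm z)"
      unfolding sdiff_def y z_def using envelope_le[OF L, of "x + v" y] envelope_le[OF L, of "x - v" y] by linarith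
    also have "\<dots> = L * (norm (z + v) + norm (z - v) - 2 * norm z)"
      by (simp add: z_def algebra_simps)
    also have "\<dots> \<le> L * ((norm v)\<^sup>2 / norm z)"
      using norm_second_difference_le[OF z0(1), of v] L by (intro mult_left_mono) auto
    also have "\<dots> = L / norm z * (norm v)\<^sup>2" by simp
    also have "\<dots> \<le> 8 * (C0 + lower) * wt (q - 2) x * (norm v)\<^sup>2"
      by (intro mult_right_mono Lz) simp
    also have "\<dots> \<le> sdiff_const * wt (q - 2) x * (norm v)\<^sup>2"
      using mult_nonneg_nonneg[OF A w] unfolding sdiff_const_def A_def[symmetric] by (simp add: algebra_simps)
    finally show ?thesis .
  next
    case 2
    have "norm y \<le> max (norm x) (min_radius 0)"
      by (rule envelope_minimizer_norm_le[OF L min])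
    then have "(norm y)\<^sup>2 \<le> (norm x)\<^sup>2 + (min_radius 0)\<^sup>2"
      by (smt (verit, best) norm_ge_zero power_mono zero_le_power2)
    moreover have "0 \<le> (min_radius 0)\<^sup>2 * (norm x)\<^sup>2" by simp
    ultimately have yx: "1 + (norm y)\<^sup>2 \<le> (4 + (min_radius 0)\<^sup>2) * (1 + (norm x)\<^sup>2)"
      using zero_le_power2[of "norm x"] unfolding distrib_left distrib_right by linarith
    have "1 + (norm x)\<^sup>2 \<le> 4 * (1 + (norm y)\<^sup>2)"
    proof (cases "norm x < 1")
      case True
      then have "(norm x)\<^sup>2 \<le> 1" by (simp add: power_le_one)
      then show ?thesis using zero_le_power2[of "norm y"] unfolding distrib_left by linarith
    next
      case False
      then have "(norm x / 2)\<^sup>2 \<le> (norm y)\<^sup>2" using 2 by (intro power_mono) auto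
      then show ?thesis by (simp add: power_divide)
    qed
    also have "\<dots> \<le> (4 + (min_radius 0)\<^sup>2) * (1 + (norm y)\<^sup>2)"
      by (intro mult_right_mono) auto
    finally have xy: "1 + (norm x)\<^sup>2 \<le> (4 + (min_radius 0)\<^sup>2) * (1 + (norm y)\<^sup>2)" .
    \<comment> \<open>Moving the competitor along with the point leaves the distances unchanged, so
      only the second difference of \<open>a\<close> at y remains. Its weight is comparable to that
      at x by \<open>yx\<close> and \<open>xy\<close>.\<close>
    have "sdiff (envelope L a) v x \<le> (a (y + v) + L * norm (x - y)) + (a (y - v) + L * norm (x - y)) - 2 * (a y + L * norm (x - y))"
      unfolding sdiff_def y using envelope_le[OF L, of "x + v" "y + v"] envelope_le[OF L, of "x - v" "y - v"]
      by (simp add: algebra_simps)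
    also have "\<dots> = sdiff a v y" by (simp add: sdiff_def)
    also have "\<dots> \<le> C1 * sdiff (wt q) v y"
      using sdiff_nonneg[OF semiconcave, of v y] by (simp add: sdiff_def algebra_simps)
    also have "\<dots> \<le> C1 * (wt_hi q * 3 powr (\<bar>q - 2\<bar> / 2) * wt (q - 2) y * (norm v)\<^sup>2)"
      by (intro mult_left_mono sdiff_wt_bounds q v C1)
    also have "\<dots> = C1 * (wt_hi q * 3 powr (\<bar>q - 2\<bar> / 2)) * (norm v)\<^sup>2 * wt (q - 2) y"
      by (simp add: mult_ac)
    also have "\<dots> \<le> C1 * (wt_hi q * 3 powr (\<bar>q - 2\<bar> / 2)) * (norm v)\<^sup>2 * ((4 + (min_radius 0)\<^sup>2) powr (\<bar>q - 2\<bar> / 2) * wt (q - 2) x)"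
      using C1 wt_hi_pos[OF q] by (intro mult_left_mono wt_comparable[OF yx xy]) auto
    also have "\<dots> = A * (wt (q - 2) x * (norm v)\<^sup>2)" by (simp add: A_def mult_ac)
    also have "\<dots> \<le> sdiff_const * (wt (q - 2) x * (norm v)\<^sup>2)"
      using C0 lower_nonneg by (intro mult_right_mono w) (simp add: sdiff_const_def A_def)
    finally show ?thesis by (simp add: mult.assoc)
  qed
qed

text \<open>Upper bound for \<open>a\<close> on the ball of radius T + 1 minus the lower bound
  \<open>- lower\<close>: it dominates the increase of \<open>a\<close> from a point of norm at most
  T to any point at unit distance.\<close>

definition slope_const :: "real \<Rightarrow> real" where
  "slope_const T = C0 * (1 + (T + 1)\<^sup>2) powr (q / 2) + lower"

text \<open>The slopes of a convex function on a ball are controlled by its oscillation on a larger ball.\<close>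

lemma envelope_eq_self:
  assumes x: "norm x \<le> T" and L: "slope_const T \<le> L"
  shows "envelope L a x = a x"
proof -
  have L0: "0 \<le> L" using L C0 lower_nonneg by (smt (verit) slope_const_def mult_nonneg_nonneg powr_ge_zero)
  have "a x \<le> a y + L * norm (x - y)" for y
  proof (cases "y = x")
    case False
    define r where "r = norm (y - x)"
    have r: "0 < r" using False by (simp add: r_def)
    \<comment> \<open>The point at unit distance from x opposite to y. Then x = (r z + y) / (1 + r),
      and convexity bounds the descent of \<open>a\<close> from x to y by r (a(z) - a(x)) <= r
      L.\<close>
    define z where "z = x - (1 / r) *\<^sub>R (y - x)"
    have "norm z \<le> norm x + norm ((1 / r) *\<^sub>R (y - x))"
      unfolding z_def by (rule norm_triangle_ineq4)
    also have "norm ((1 / r) *\<^sub>R (y - x)) = 1" using False by (simp add: r_def)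
    finally have "norm z \<le> T + 1" using x by simp
    then have "a z \<le> C0 * (1 + (T + 1)\<^sup>2) powr (q / 2)"
      using upper[of z] q C0 unfolding wt_def
      by (intro order_trans[OF upper[unfolded wt_def]] mult_left_mono powr_mono2 add_left_mono power_mono) auto
    then have zx: "a z - a x \<le> L" using L lower_bound[of x] by (simp add: slope_const_def)
    have "x = (1 - 1 / (1 + r)) *\<^sub>R z + (1 / (1 + r)) *\<^sub>R y"
    proof -
      have "(1 + r) *\<^sub>R ((1 - 1 / (1 + r)) *\<^sub>R z + (1 / (1 + r)) *\<^sub>R y) = r *\<^sub>R z + y"
        using r by (simp add: scaleR_add_right right_diff_distrib)
      also have "\<dots> = (1 + r) *\<^sub>R x" using r by (simp add: z_def algebra_simps)
      finally show ?thesis using r by simp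
    qed
    then have "a x \<le> (1 - 1 / (1 + r)) * a z + 1 / (1 + r) * a y"
      using convex_onD[OF convex, of "1 / (1 + r)" z y] r by simp
    then have "(1 + r) * a x \<le> (1 + r) * ((1 - 1 / (1 + r)) * a z + 1 / (1 + r) * a y)"
      using r by (intro mult_left_mono) auto
    also have "\<dots> = r * a z + a y"
    proof -
      have "(1 + r) * (1 - 1 / (1 + r)) = r" "(1 + r) * (1 / (1 + r)) = 1"
        using r by (simp_all add: field_simps)
      then show ?thesis unfolding distrib_left mult.assoc[symmetric] by simp
    qed
    finally have "a x \<le> a y + r * (a z - a x)" by (simp add: algebra_simps)
    also have "\<dots> \<le> a y + r * L" using zx r by simp
    finally show ?thesis by (simp add: r_def norm_minus_commute mult.commute)
  qed simp
  moreover obtain y where "envelope L a x = a y + L * norm (x - y)"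
    using envelope_attained[OF L0] by metis
  ultimately show ?thesis using envelope_le_self[OF L0, of x] by (metis order_antisym)
qed

end

text \<open>Each envelope is tested with the minimiser of the other. Both minimisers lie in the same
  ball, so closeness on that ball gives closeness at every x.\<close>

lemma envelope_diff_le:
  assumes a: "coercive_convex a p q k C0 C1" and b: "coercive_convex b p q k C0 C1" and L: "0 \<le> L"
    and d: "\<And>y. norm y \<le> coercive_radius p k (2 * C0) (C0 + L) \<Longrightarrow> \<bar>a y - b y\<bar> \<le> e"
  shows "\<bar>envelope L a x - envelope L b x\<bar> \<le> e"
proof -
  interpret a: coercive_convex a p q k C0 C1 by (rule a)
  interpret b: coercive_convex b p q k C0 C1 by (rule b)
  obtain y where "norm y \<le> coercive_radius p k (2 * C0) (C0 + L)" "envelope L a x = a y + L * norm (x - y)"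
    using a.envelope_attained[OF L] unfolding a.min_radius_def by metis
  moreover obtain z where "norm z \<le> coercive_radius p k (2 * C0) (C0 + L)" "envelope L b x = b z + L * norm (x - z)"
    using b.envelope_attained[OF L] unfolding b.min_radius_def by metis
  ultimately show ?thesis
    using b.envelope_le[OF L, of x y] a.envelope_le[OF L, of x z] d[of y] d[of z] by linarith
qed

subsection \<open>Mollification by iterated averages\<close>

text \<open>Average over the one-sided segment from x to x + e e_i. This kernel makes the derivative
  in direction i exactly the difference quotient \<open>diff_quot\<close>.\<close>

definition box_avg :: "real \<Rightarrow> 'n::finite \<Rightarrow> (real^'n \<Rightarrow> real) \<Rightarrow> real^'n \<Rightarrow> real" where
  "box_avg e i F x = integral {0..1} (\<lambda>s. F (x + (e * s) *\<^sub>R axis i 1))"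

definition diff_quot :: "real \<Rightarrow> 'n::finite \<Rightarrow> (real^'n \<Rightarrow> real) \<Rightarrow> real^'n \<Rightarrow> real" where
  "diff_quot e i F x = (F (x + e *\<^sub>R axis i 1) - F x) / e"

lemma continuous_on_shift:
  fixes F :: "'a::real_normed_vector \<Rightarrow> real"
  assumes "continuous_on UNIV F"
  shows "continuous_on S (\<lambda>s. F (x + (e * s) *\<^sub>R v))"
  by (rule continuous_on_compose2[OF assms]) (auto intro!: continuous_intros)

lemma box_avg_integrable:
  fixes F :: "real^'n::finite \<Rightarrow> real"
  shows "continuous_on UNIV F \<Longrightarrow> (\<lambda>s. F (x + (e * s) *\<^sub>R axis i 1)) integrable_on {0..1}"
  by (intro integrable_continuous_real continuous_on_shift)

lemma continuous_box_avg:
  assumes "continuous_on UNIV F"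
  shows "continuous_on UNIV (box_avg e i F)"
proof -
  have "continuous_on (UNIV \<times> cbox 0 1) (\<lambda>(x, s). F (x + (e * s) *\<^sub>R axis i 1))"
    unfolding case_prod_beta
    by (rule continuous_on_compose2[OF assms]) (auto intro!: continuous_intros)
  from integral_continuous_on_param[OF this] show ?thesis
    unfolding box_avg_def[abs_def] by simp
qed

lemma continuous_diff_quot:
  assumes "continuous_on UNIV F"
  shows "continuous_on UNIV (diff_quot e i F)"
proof -
  have "continuous_on UNIV (\<lambda>x. F (x + e *\<^sub>R axis i 1))"
    by (rule continuous_on_compose2[OF assms]) (auto intro!: continuous_intros)
  then show ?thesis
    unfolding diff_quot_def[abs_def] divide_inverse by (intro continuous_intros assms)
qed

text \<open>With a primitive \<Phi> of F along the line, the average at parameter t is (\<Phi>(t +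
  e) - \<Phi>(t)) / e. The interval from -2 to 2 + e keeps all arguments interior for |t| <
  1.\<close>

lemma box_avg_line_deriv:
  fixes F :: "real^'n \<Rightarrow> real"
  assumes F: "continuous_on UNIV F" and e: "0 < e"
  shows "((\<lambda>t. box_avg e i F (x + t *\<^sub>R axis i 1)) has_real_derivative diff_quot e i F x) (at 0)"
proof -
  define \<phi> where "\<phi> = (\<lambda>r. F (x + r *\<^sub>R axis i 1))"
  have "continuous_on {-2..2 + e} \<phi>"
    using continuous_on_shift[OF F, of _ x 1] by (simp add: \<phi>_def)
  then obtain \<Phi> where \<Phi>: "\<And>r. r \<in> {-2..2 + e} \<Longrightarrow> (\<Phi> has_vector_derivative \<phi> r) (at r within {-2..2 + e})"
    using antiderivative_continuous by metis
  have D: "(\<Phi> has_real_derivative \<phi> r) (at r)" if "-2 < r" "r < 2 + e" for r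
    using \<Phi>[of r] that at_within_Icc_at[of "-2" r "2 + e"]
    by (simp add: has_real_derivative_iff_has_vector_derivative)
  have eq: "box_avg e i F (x + t *\<^sub>R axis i 1) = (\<Phi> (t + e) - \<Phi> t) / e" if t: "\<bar>t\<bar> < 1" for t
  proof -
    have "((\<lambda>s. \<phi> (t + e * s)) has_integral (\<Phi> (t + e * 1) / e - \<Phi> (t + e * 0) / e)) {0..1}"
    proof (rule fundamental_theorem_of_calculus)
      fix s :: real assume s: "s \<in> {0..1}"
      have "e * s \<le> e * 1" "0 \<le> e * s" using mult_left_mono[of s 1 e] s e by auto
      then have "(\<Phi> has_real_derivative \<phi> (t + e * s)) (at (t + e * s))"
        using t by (intro D) linarith+
      moreover have "((\<lambda>s. t + e * s) has_real_derivative e) (at s)"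
        by (auto intro!: derivative_eq_intros)
      ultimately have "((\<lambda>s. \<Phi> (t + e * s)) has_real_derivative \<phi> (t + e * s) * e) (at s)"
        by (rule DERIV_chain2)
      from DERIV_cdivide[OF this, of e]
      show "((\<lambda>s. \<Phi> (t + e * s) / e) has_vector_derivative \<phi> (t + e * s)) (at s within {0..1})"
        using e by (simp add: has_real_derivative_iff_has_vector_derivative[symmetric] has_field_derivative_at_within)
    qed simp
    then show ?thesis
      by (simp add: box_avg_def \<phi>_def integral_unique scaleR_add_left add.assoc diff_divide_distrib)
  qed
  have "((\<lambda>t. t + e) has_real_derivative 1) (at 0)"
    by (auto intro!: derivative_eq_intros)
  moreover have "(\<Phi> has_real_derivative \<phi> (0 + e)) (at (0 + e))" using e by (intro D) auto
  ultimately have "((\<lambda>t. \<Phi> (t + e)) has_real_derivative \<phi> (0 + e) * 1) (at 0)"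
    by (rule DERIV_chain2[rotated])
  then have "((\<lambda>t. (\<Phi> (t + e) - \<Phi> t) / e) has_real_derivative (\<phi> (0 + e) * 1 - \<phi> 0) / e) (at 0)"
    using e by (intro DERIV_cdivide DERIV_diff D) auto
  then have "((\<lambda>t. (\<Phi> (t + e) - \<Phi> t) / e) has_real_derivative diff_quot e i F x) (at 0)"
    by (simp add: diff_quot_def \<phi>_def)
  then show ?thesis
    by (rule has_field_derivative_transform_within_open[where S = "{-1<..<1}"]) (auto simp: eq)
qed

lemma box_avg_partial:
  fixes F :: "real^'n \<Rightarrow> real"
  assumes "continuous_on UNIV F" "0 < e"
  shows "has_partial i (box_avg e i F) x" and "partial i (box_avg e i F) = diff_quot e i F"
  using has_partialI[OF box_avg_line_deriv[OF assms]] by auto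

lemma box_avg_commute:
  fixes F :: "real^'n \<Rightarrow> real"
  assumes "continuous_on UNIV F"
  shows "box_avg e i (box_avg e j F) = box_avg e j (box_avg e i F)"
proof
  fix x
  have "continuous_on (cbox (0, 0) (1, 1)) (\<lambda>(s, t). F (x + (e * s) *\<^sub>R axis i 1 + (e * t) *\<^sub>R axis j 1))"
    unfolding case_prod_beta
    by (rule continuous_on_compose2[OF assms]) (auto intro!: continuous_intros)
  from integral_swap_continuous[OF this]
  show "box_avg e i (box_avg e j F) x = box_avg e j (box_avg e i F) x"
    by (simp add: box_avg_def add_ac)
qed

lemma box_avg_linear:
  fixes F G :: "real^'n \<Rightarrow> real"
  assumes "continuous_on UNIV F" "continuous_on UNIV G"
  shows "box_avg e i (\<lambda>x. c * F x + d * G x) = (\<lambda>x. c * box_avg e i F x + d * box_avg e i G x)"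
proof
  fix x
  have "(\<lambda>s. c * F (x + (e * s) *\<^sub>R axis i 1)) integrable_on {0..1}"
    "(\<lambda>s. d * G (x + (e * s) *\<^sub>R axis i 1)) integrable_on {0..1}"
    using assms by (auto intro!: integrable_continuous_real continuous_intros continuous_on_shift)
  then show "box_avg e i (\<lambda>x. c * F x + d * G x) x = c * box_avg e i F x + d * box_avg e i G x"
    unfolding box_avg_def by (simp add: integral_add)
qed

lemma box_avg_shift: "box_avg e i (\<lambda>x. F (x + v)) = (\<lambda>x. box_avg e i F (x + v))"
  by (simp add: fun_eq_iff box_avg_def add_ac)

lemma box_avg_diff_quot:
  assumes "continuous_on UNIV F"
  shows "box_avg e i (diff_quot e j F) = diff_quot e j (box_avg e i F)"
proof -
  have c: "continuous_on UNIV (\<lambda>x. F (x + e *\<^sub>R axis j 1))"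
    by (rule continuous_on_compose2[OF assms]) (auto intro!: continuous_intros)
  have eq: "diff_quot e j G = (\<lambda>x. (1 / e) * G (x + e *\<^sub>R axis j 1) + (- 1 / e) * G x)" for G
    by (simp add: fun_eq_iff diff_quot_def diff_divide_distrib)
  show ?thesis
    unfolding eq box_avg_linear[OF c assms] box_avg_shift ..
qed

lemma diff_quot_commute: "diff_quot e i (diff_quot e j F) = diff_quot e j (diff_quot e i F)"
  by (simp add: fun_eq_iff diff_quot_def diff_divide_distrib add_ac)

definition iter_avg :: "real \<Rightarrow> 'n::finite list \<Rightarrow> (real^'n \<Rightarrow> real) \<Rightarrow> real^'n \<Rightarrow> real" where
  "iter_avg e L F = foldr (box_avg e) L F"

lemma iter_avg_Nil: "iter_avg e [] F = F"
  and iter_avg_Cons: "iter_avg e (i # L) F = box_avg e i (iter_avg e L F)"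
  by (simp_all add: iter_avg_def)

lemma continuous_iter_avg:
  "continuous_on UNIV F \<Longrightarrow> continuous_on UNIV (iter_avg e L F)"
  by (induction L) (auto simp: iter_avg_Nil iter_avg_Cons intro: continuous_box_avg)

text \<open>Brings one average in direction i to the outside, where the partial derivative in that
  direction can act on it.\<close>

lemma iter_avg_remove1:
  assumes "continuous_on UNIV F" "i \<in> set L"
  shows "iter_avg e L F = box_avg e i (iter_avg e (remove1 i L) F)"
  using assms(2)
proof (induction L)
  case (Cons j L)
  then show ?case
    using box_avg_commute[OF continuous_iter_avg[OF assms(1)]]
    by (auto simp: iter_avg_Cons)
qed simp

lemma iter_avg_diff_quot:
  assumes "continuous_on UNIV F"
  shows "iter_avg e L (diff_quot e j F) = diff_quot e j (iter_avg e L F)"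
  by (induction L) (simp_all add: iter_avg_Nil iter_avg_Cons box_avg_diff_quot continuous_iter_avg assms)

lemma iter_avg_linear:
  assumes "continuous_on UNIV F" "continuous_on UNIV G"
  shows "iter_avg e L (\<lambda>x. c * F x + d * G x) = (\<lambda>x. c * iter_avg e L F x + d * iter_avg e L G x)"
  by (induction L) (simp_all add: iter_avg_Nil iter_avg_Cons box_avg_linear continuous_iter_avg assms)

lemma iter_avg_shift: "iter_avg e L (\<lambda>x. F (x + v)) = (\<lambda>x. iter_avg e L F (x + v))"
  by (induction L) (simp_all add: iter_avg_Nil iter_avg_Cons box_avg_shift)

text \<open>Averaging is linear and commutes with translations.\<close>

lemma sdiff_iter_avg:
  assumes F: "continuous_on UNIV F"
  shows "sdiff (iter_avg e L F) v = iter_avg e L (sdiff F v)"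
proof -
  have c: "continuous_on UNIV (\<lambda>x. F (x + w))" for w
    by (rule continuous_on_compose2[OF F]) (auto intro!: continuous_intros)
  have c2: "continuous_on UNIV (\<lambda>x. 1 * F (x + v) + 1 * F (x + - v))"
    by (intro continuous_intros c)
  \<comment> \<open>Nested two-term combinations, to match the form of
    \<open>iter_avg_linear\<close>.\<close>
  have eq: "sdiff G v = (\<lambda>x. 1 * (1 * G (x + v) + 1 * G (x + - v)) + (- 2) * G x)" for G :: "real^'a \<Rightarrow> real"
    by (simp add: fun_eq_iff sdiff_def)
  show ?thesis
    unfolding eq iter_avg_linear[OF c2 F] iter_avg_linear[OF c c] iter_avg_shift ..
qed

text \<open>Each averaging preserves pointwise bounds and looks at most e farther, so the bounds are
  required on a ball of radius e times the number of averages.\<close>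

lemma iter_avg_bounds:
  fixes F :: "real^'n \<Rightarrow> real"
  assumes F: "continuous_on UNIV F" and e: "0 \<le> e"
    and "\<And>y. norm (y - x) \<le> e * real (length L) \<Longrightarrow> l \<le> F y \<and> F y \<le> u"
  shows "l \<le> iter_avg e L F x \<and> iter_avg e L F x \<le> u"
  using assms(3)
proof (induction L arbitrary: x)
  case Nil
  then show ?case by (simp add: iter_avg_Nil)
next
  case (Cons i L)
  define G where "G = (\<lambda>s. iter_avg e L F (x + (e * s) *\<^sub>R axis i 1))"
  have int: "G integrable_on {0..1}"
    unfolding G_def by (rule box_avg_integrable[OF continuous_iter_avg[OF F]])
  have G: "l \<le> G s \<and> G s \<le> u" if s: "s \<in> {0..1}" for s
    unfolding G_def
  proof (rule Cons.IH)
    fix y assume "norm (y - (x + (e * s) *\<^sub>R axis i 1)) \<le> e * real (length L)"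
    moreover have "norm ((e * s) *\<^sub>R axis i (1::real)) \<le> e * 1"
      using mult_left_mono[of s 1 e] s e by auto
    ultimately have "norm (y - x) \<le> e * real (length (i # L))"
      using norm_triangle_ineq[of "y - (x + (e * s) *\<^sub>R axis i 1)" "(e * s) *\<^sub>R axis i 1"]
      by (simp add: algebra_simps)
    then show "l \<le> F y \<and> F y \<le> u" by (rule Cons.prems)
  qed
  have "l \<le> integral {0..1} G"
    using integral_le[OF integrable_continuous_real[OF continuous_on_const] int, of l] G by simp
  moreover have "integral {0..1} G \<le> u"
    using integral_le[OF int integrable_continuous_real[OF continuous_on_const], of u] G by simp
  ultimately show ?case by (simp add: iter_avg_Cons box_avg_def G_def)
qed

lemma iter_avg_partial:
  fixes F :: "real^'n \<Rightarrow> real"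
  assumes F: "continuous_on UNIV F" and e: "0 < e" and i: "i \<in> set L"
  shows "has_partial i (iter_avg e L F) x"
    and "partial i (iter_avg e L F) = iter_avg e (remove1 i L) (diff_quot e i F)"
  unfolding iter_avg_remove1[OF F i] iter_avg_diff_quot[OF F]
  by (intro box_avg_partial continuous_iter_avg F e)+

definition coords :: "'n::finite list" where
  "coords = (SOME xs. set xs = UNIV \<and> distinct xs)"

lemma set_coords: "set (coords :: 'n::finite list) = UNIV" and distinct_coords: "distinct (coords :: 'n::finite list)"
  using someI_ex[OF finite_distinct_list[OF finite, of "UNIV :: 'n set"]] unfolding coords_def by auto

text \<open>Averaging twice along every coordinate direction gains two derivatives, which are difference
  quotients of averages; averages commute by Fubini's theorem.\<close>

definition mollify :: "real \<Rightarrow> (real^'n \<Rightarrow> real) \<Rightarrow> real^'n \<Rightarrow> real" where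
  "mollify e F = iter_avg e (coords @ coords) F"

lemma length_coords: "length (coords :: 'n::finite list) = CARD('n)"
  using distinct_card[OF distinct_coords[where 'n = 'n]] by (simp add: set_coords)

lemma mollify_second_partial:
  fixes F :: "real^'n \<Rightarrow> real"
  assumes F: "continuous_on UNIV F" and e: "0 < e"
  defines "L \<equiv> coords @ coords"
  shows "has_partial i (mollify e F) x" "has_partial j (partial i (mollify e F)) x"
    and "partial i (mollify e F) = iter_avg e (remove1 i L) (diff_quot e i F)"
    and "partial j (partial i (mollify e F)) = iter_avg e (remove1 j (remove1 i L)) (diff_quot e j (diff_quot e i F))"
proof -
  have i: "i \<in> set L" by (simp add: L_def set_coords)
  \<comment> \<open>Doubling the list matters here: after one copy of i is spent, j is still
    available, even for j = i.\<close>
  have j: "j \<in> set (remove1 i L)" by (simp add: L_def set_coords remove1_append)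
  note 1 = iter_avg_partial[OF F e i] and 2 = iter_avg_partial[OF continuous_diff_quot[OF F] e j]
  show "has_partial i (mollify e F) x" "partial i (mollify e F) = iter_avg e (remove1 i L) (diff_quot e i F)"
    using 1 by (auto simp: mollify_def L_def)
  then show "has_partial j (partial i (mollify e F)) x"
    "partial j (partial i (mollify e F)) = iter_avg e (remove1 j (remove1 i L)) (diff_quot e j (diff_quot e i F))"
    using 2 by auto
qed

lemma C2_mollify:
  fixes F :: "real^'n \<Rightarrow> real"
  assumes F: "continuous_on UNIV F" and e: "0 < e"
  shows "C2 (mollify e F)"
  unfolding C2_def
proof (intro conjI allI)
  show "continuous_on UNIV (mollify e F)"
    unfolding mollify_def by (intro continuous_iter_avg F)
  fix i j :: 'n
  show "has_partial i (mollify e F) x" "has_partial j (partial i (mollify e F)) x" for x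
    by (intro mollify_second_partial F e)+
  show "continuous_on UNIV (partial i (mollify e F))"
    unfolding mollify_second_partial(3)[OF F e] by (intro continuous_iter_avg continuous_diff_quot F)
  show "continuous_on UNIV (partial j (partial i (mollify e F)))"
    unfolding mollify_second_partial(4)[OF F e] by (intro continuous_iter_avg continuous_diff_quot F)
qed

lemma mollify_mixed_partials:
  assumes F: "continuous_on UNIV F" and e: "0 < e"
  shows "partial j (partial i (mollify e F)) = partial i (partial j (mollify e F))"
  unfolding mollify_second_partial(4)[OF F e] diff_quot_commute[of e j i] remove1_commute[of j i] ..

lemma mollify_bounds:
  fixes F :: "real^'n \<Rightarrow> real"
  assumes "continuous_on UNIV F" "0 \<le> e"
    and "\<And>y. norm (y - x) \<le> e * (2 * real CARD('n)) \<Longrightarrow> l \<le> F y \<and> F y \<le> u"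
  shows "l \<le> mollify e F x \<and> mollify e F x \<le> u"
  unfolding mollify_def using assms by (intro iter_avg_bounds) (auto simp: length_coords)

lemma sdiff_mollify:
  "continuous_on UNIV F \<Longrightarrow> sdiff (mollify e F) v = mollify e (sdiff F v)"
  unfolding mollify_def by (rule sdiff_iter_avg)

lemma continuous_sdiff:
  fixes F :: "'a::real_normed_vector \<Rightarrow> real"
  assumes "continuous_on UNIV F"
  shows "continuous_on UNIV (sdiff F v)"
proof -
  have "continuous_on UNIV (\<lambda>x. F (x + w))" for w
    by (rule continuous_on_compose2[OF assms]) (auto intro!: continuous_intros)
  from this[of v] this[of "- v"] show ?thesis
    unfolding sdiff_def[abs_def] by (intro continuous_intros assms) simp_all
qed

subsection \<open>Truncated integrands\<close>

definition truncation :: "real \<Rightarrow> real \<Rightarrow> real \<Rightarrow> ('a::real_inner \<Rightarrow> real) \<Rightarrow> 'a \<Rightarrow> real" where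
  "truncation p k L a x = k * wt p x + envelope L a x"

context coercive_convex
begin

lemma continuous_truncation:
  assumes "0 \<le> L"
  shows "continuous_on UNIV (truncation p k L a)"
proof -
  have "continuous_on UNIV (envelope L a)"
    using convex_on_continuous[OF open_UNIV convex_on_envelope[OF assms]] .
  then show ?thesis
    unfolding truncation_def[abs_def] by (intro continuous_intros continuous_on_wt)
qed

lemma truncation_le: "0 \<le> L \<Longrightarrow> truncation p k L a x \<le> k * wt p x + a x"
  using envelope_le_self by (simp add: truncation_def)

lemma truncation_eq: "norm x \<le> T \<Longrightarrow> slope_const T \<le> L \<Longrightarrow> truncation p k L a x = k * wt p x + a x"
  using envelope_eq_self by (simp add: truncation_def)

text \<open>On the ball of radius T the truncation is the original function. Outside, k
  \<open>wt p\<close> >= k T >= \<open>lower\<close> outweighs the lower bound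
  \<open>- lower\<close> of the envelope.\<close>

lemma truncation_nonneg:
  assumes "\<And>x. 0 \<le> k * wt p x + a x" "0 \<le> L" "slope_const T \<le> L" "lower \<le> k * T"
  shows "0 \<le> truncation p k L a x"
proof (cases "norm x \<le> T")
  case True
  then show ?thesis using truncation_eq[OF True assms(3)] assms(1)[of x] by simp
next
  case False
  have "k * T \<le> k * norm x" using False k by simp
  also have "\<dots> \<le> k * wt p x" using k p by (intro mult_left_mono norm_le_wt) auto
  finally show ?thesis using envelope_ge[OF assms(2), of x] assms(4) by (simp add: truncation_def)
qed

text \<open>The envelope moves by at most L d <= \<epsilon>, the weight by a multiple of \<epsilon>
  \<open>wt p x\<close>. An error relative to \<open>wt p\<close> is what integrability of |Du|^p
  can absorb.\<close>

lemma truncation_close: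
  assumes L: "0 \<le> L" and xy: "norm (y - x) \<le> d" and d: "d \<le> 1" "d * (L + 1) \<le> \<epsilon>"
  shows "\<bar>truncation p k L a y - truncation p k L a x\<bar> \<le> \<epsilon> * (k * (p * 3 powr (p / 2)) + 1) * wt p x"
proof -
  have d0: "0 \<le> d" using xy norm_ge_zero[of "y - x"] by linarith
  have "0 \<le> L * d" "d * (L + 1) = L * d + d" using d0 L by (simp_all add: algebra_simps)
  then have dL: "d \<le> \<epsilon>" "L * d \<le> \<epsilon>" using d d0 by linarith+
  have "\<bar>wt p y - wt p x\<bar> \<le> p * 3 powr (p / 2) * wt p x * norm (y - x)"
    using p xy d by (intro wt_gradient_bound) auto
  also have "\<dots> \<le> p * 3 powr (p / 2) * wt p x * \<epsilon>"
    using p wt_pos[of p x] xy dL by (intro mult_left_mono) auto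
  finally have "k * \<bar>wt p y - wt p x\<bar> \<le> k * (p * 3 powr (p / 2) * wt p x * \<epsilon>)"
    using k by (intro mult_left_mono) auto
  moreover have "\<bar>envelope L a y - envelope L a x\<bar> \<le> \<epsilon> * wt p x"
  proof -
    have "\<bar>envelope L a y - envelope L a x\<bar> \<le> L * norm (y - x)" by (rule envelope_Lipschitz[OF L])
    also have "\<dots> \<le> L * d" using xy L by (intro mult_left_mono)
    also have "\<dots> \<le> \<epsilon>" by fact
    also have "\<dots> \<le> \<epsilon> * wt p x"
      using mult_left_mono[OF wt_ge_1[of p x], of \<epsilon>] p d0 dL by simp
    finally show ?thesis .
  qed
  moreover have "\<bar>truncation p k L a y - truncation p k L a x\<bar> \<le> k * \<bar>wt p y - wt p x\<bar> + \<bar>envelope L a y - envelope L a x\<bar>"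
  proof -
    have "truncation p k L a y - truncation p k L a x = k * (wt p y - wt p x) + (envelope L a y - envelope L a x)"
      by (simp add: truncation_def algebra_simps)
    moreover have "\<bar>k * (wt p y - wt p x)\<bar> = k * \<bar>wt p y - wt p x\<bar>" using k by (simp add: abs_mult)
    ultimately show ?thesis by linarith
  qed
  ultimately show ?thesis by (simp add: algebra_simps)
qed

text \<open>Of the two equal divisors, one comes from the Taylor points in
  \<open>sdiff_wt_bounds\<close>, the other from moving the weight from a point of the averaging
  region to its base point. The same holds for the two powers of 3 in
  \<open>growth_const\<close>.\<close>

definition ell_const :: real where
  "ell_const = k * (wt_lo p / 3 powr (\<bar>p - 2\<bar> / 2)) / 3 powr (\<bar>p - 2\<bar> / 2)"

definition growth_const :: real where
  "growth_const = (k * (wt_hi p * 3 powr (\<bar>p - 2\<bar> / 2)) + sdiff_const) * 3 powr (\<bar>q - 2\<bar> / 2)"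

lemma ell_const_pos: "0 < ell_const"
  using k wt_lo_pos[OF p] by (simp add: ell_const_def)

lemma growth_const_pos: "0 < growth_const"
proof -
  have "0 < k * (wt_hi p * 3 powr (\<bar>p - 2\<bar> / 2))" using k wt_hi_pos[OF p] by simp
  moreover have "0 \<le> sdiff_const"
    using C0 C1 lower_nonneg wt_hi_pos[OF q] by (simp add: sdiff_const_def)
  ultimately show ?thesis by (simp add: growth_const_def)
qed

text \<open>The weight sits at x and the difference at a nearby y, so that the bounds are constant
  over the averaging region. Ellipticity comes from \<open>wt p\<close> alone, the convex envelope
  contributing a nonnegative amount.\<close>

lemma sdiff_truncation_bounds:
  assumes L: "0 \<le> L" and v: "norm v \<le> 1" and xy: "norm (y - x) \<le> 1" and pq: "p \<le> q"
  shows "ell_const * wt (p - 2) x * (norm v)\<^sup>2 \<le> sdiff (truncation p k L a) v y"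
    and "sdiff (truncation p k L a) v y \<le> growth_const * wt (q - 2) x * (norm v)\<^sup>2"
proof -
  have eq: "sdiff (truncation p k L a) v y = k * sdiff (wt p) v y + sdiff (envelope L a) v y"
    by (simp add: sdiff_def truncation_def algebra_simps)
  define c where "c = 3 powr (\<bar>p - 2\<bar> / 2)"
  have c: "0 < c" by (simp add: c_def)
  have "wt (p - 2) x \<le> c * wt (p - 2) y"
    unfolding c_def using xy by (intro wt_shift) (simp add: norm_minus_commute)
  then have "wt (p - 2) x / c \<le> wt (p - 2) y" using c by (simp add: field_simps)
  then have "k * (wt_lo p / c) * (wt (p - 2) x / c) * (norm v)\<^sup>2 \<le> k * (wt_lo p / c) * wt (p - 2) y * (norm v)\<^sup>2"
    using k c wt_lo_pos[OF p] by (intro mult_right_mono mult_left_mono) auto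
  also have "\<dots> = k * (wt_lo p / c * wt (p - 2) y * (norm v)\<^sup>2)" by (simp add: mult.assoc)
  also have "\<dots> \<le> k * sdiff (wt p) v y"
    unfolding c_def using k by (intro mult_left_mono sdiff_wt_bounds p v) auto
  also have "\<dots> \<le> sdiff (truncation p k L a) v y"
    using sdiff_nonneg[OF convex_on_envelope[OF L], of v y] by (simp add: eq)
  finally show "ell_const * wt (p - 2) x * (norm v)\<^sup>2 \<le> sdiff (truncation p k L a) v y"
    by (simp add: ell_const_def c_def)
  define A where "A = k * (wt_hi p * c)"
  have A: "0 < A" "0 \<le> sdiff_const"
    using k c wt_hi_pos[OF p] C0 C1 lower_nonneg wt_hi_pos[OF q] by (auto simp: A_def sdiff_const_def)
  have "k * sdiff (wt p) v y \<le> k * (wt_hi p * c * wt (p - 2) y * (norm v)\<^sup>2)"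
    unfolding c_def using k by (intro mult_left_mono sdiff_wt_bounds p v) auto
  also have "\<dots> = A * wt (p - 2) y * (norm v)\<^sup>2" by (simp add: A_def mult.assoc)
  also have "\<dots> \<le> A * wt (q - 2) y * (norm v)\<^sup>2"
    using A pq by (intro mult_right_mono mult_left_mono wt_mono_exponent) auto
  finally have "sdiff (truncation p k L a) v y \<le> (A + sdiff_const) * wt (q - 2) y * (norm v)\<^sup>2"
    using sdiff_envelope_le[OF L v, of y] by (simp add: eq algebra_simps)
  also have "\<dots> \<le> (A + sdiff_const) * (3 powr (\<bar>q - 2\<bar> / 2) * wt (q - 2) x) * (norm v)\<^sup>2"
    using A by (intro mult_right_mono mult_left_mono wt_shift xy) auto
  finally show "sdiff (truncation p k L a) v y \<le> growth_const * wt (q - 2) x * (norm v)\<^sup>2"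
    by (simp add: growth_const_def A_def c_def mult.assoc)
qed

end

section \<open>Mollified truncations\<close>

locale coercive_convex_vec = coercive_convex a p q k C0 C1
  for a :: "real^'n \<Rightarrow> real" and p q k C0 C1 +
  assumes pq: "p \<le> q"
begin

context
  fixes L e :: real
  assumes L: "0 \<le> L" and e: "0 < e" and e1: "e * (2 * real CARD('n)) \<le> 1"
begin

lemma C2_regularized: "C2 (mollify e (truncation p k L a))"
  by (intro C2_mollify continuous_truncation L e)

lemma sdiff_regularized_bounds:
  assumes "norm v \<le> 1"
  shows "ell_const * wt (p - 2) x * (norm v)\<^sup>2 \<le> sdiff (mollify e (truncation p k L a)) v x \<and>
    sdiff (mollify e (truncation p k L a)) v x \<le> growth_const * wt (q - 2) x * (norm v)\<^sup>2"
  unfolding sdiff_mollify[OF continuous_truncation[OF L]]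
proof (rule mollify_bounds)
  fix y assume "norm (y - x) \<le> e * (2 * real CARD('n))"
  then have "norm (y - x) \<le> 1" using e1 by linarith
  then show "ell_const * wt (p - 2) x * (norm v)\<^sup>2 \<le> sdiff (truncation p k L a) v y \<and>
    sdiff (truncation p k L a) v y \<le> growth_const * wt (q - 2) x * (norm v)\<^sup>2"
    using sdiff_truncation_bounds[OF L assms _ pq] by blast
qed (use e continuous_sdiff[OF continuous_truncation[OF L]] in auto)

lemma hess_form_regularized_bounds:
  shows "ell_const * wt (p - 2) x * (norm v)\<^sup>2 \<le> hess_form (mollify e (truncation p k L a)) v x"
    and "hess_form (mollify e (truncation p k L a)) v x \<le> growth_const * wt (q - 2) x * (norm v)\<^sup>2"
  using sdiff_regularized_bounds by (intro hess_form_bounds C2_regularized; blast)+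

lemma hess_form_regularized_pos:
  assumes "v \<noteq> 0"
  shows "0 < hess_form (mollify e (truncation p k L a)) v x"
proof -
  have "0 < ell_const * wt (p - 2) x * (norm v)\<^sup>2"
    using assms ell_const_pos wt_pos[of "p - 2" x] by simp
  also note hess_form_regularized_bounds(1)
  finally show ?thesis .
qed

lemma strictly_convex_regularized: "strictly_convex (mollify e (truncation p k L a))"
  by (intro strictly_convexI_hess_form C2_regularized hess_form_regularized_pos)

lemma norm_hessian_regularized_le:
  "norm (\<chi> i j. partial j (partial i (mollify e (truncation p k L a))) x) \<le> (real CARD('n))\<^sup>2 * growth_const * wt (q - 2) x"
proof -
  have "0 \<le> hess_form (mollify e (truncation p k L a)) v x" for v
    using hess_form_regularized_pos[of v x] by (cases "v = 0") (auto simp: hess_form_def)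
  from norm_hessian_le[OF this hess_form_regularized_bounds(2) mollify_mixed_partials[OF continuous_truncation[OF L] e, THEN fun_cong]]
  show ?thesis by (simp add: mult.assoc)
qed

lemma regularized_nonneg:
  assumes "\<And>x. 0 \<le> truncation p k L a x"
  shows "0 \<le> mollify e (truncation p k L a) x"
proof -
  \<comment> \<open>\<open>mollify_bounds\<close> asks for two-sided bounds; compactness supplies
    some upper one.\<close>
  have "compact (truncation p k L a ` cball x (e * (2 * real CARD('n))))"
    using continuous_on_subset[OF continuous_truncation[OF L]] by (intro compact_continuous_image) auto
  from compact_imp_bounded[OF this]
  obtain u where "\<forall>z\<in>truncation p k L a ` cball x (e * (2 * real CARD('n))). norm z \<le> u"
    unfolding bounded_iff by blast
  then have u: "\<bar>truncation p k L a y\<bar> \<le> u" if "y \<in> cball x (e * (2 * real CARD('n)))" for y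
    using that by auto
  have "0 \<le> mollify e (truncation p k L a) x \<and> mollify e (truncation p k L a) x \<le> u"
  proof (rule mollify_bounds[OF continuous_truncation[OF L]])
    fix y assume "norm (y - x) \<le> e * (2 * real CARD('n))"
    then have "\<bar>truncation p k L a y\<bar> \<le> u" by (intro u) (simp add: dist_norm norm_minus_commute)
    then show "0 \<le> truncation p k L a y \<and> truncation p k L a y \<le> u" using assms[of y] by linarith
  qed (use e in simp)
  then show ?thesis ..
qed

lemma regularized_close:
  assumes "e * (2 * real CARD('n)) * (L + 1) \<le> \<epsilon>"
  shows "\<bar>mollify e (truncation p k L a) x - truncation p k L a x\<bar> \<le> \<epsilon> * (k * (p * 3 powr (p / 2)) + 1) * wt p x"
proof -
  define E where "E = \<epsilon> * (k * (p * 3 powr (p / 2)) + 1) * wt p x"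
  have "\<bar>truncation p k L a y - truncation p k L a x\<bar> \<le> E" if "norm (y - x) \<le> e * (2 * real CARD('n))" for y
    unfolding E_def by (rule truncation_close[OF L that e1 assms])
  then have "truncation p k L a x - E \<le> mollify e (truncation p k L a) x \<and>
      mollify e (truncation p k L a) x \<le> truncation p k L a x + E"
    using e by (intro mollify_bounds continuous_truncation L) (auto simp: abs_le_iff algebra_simps)
  then show ?thesis unfolding E_def by (auto simp: abs_le_iff)
qed

end

end

subsection \<open>The integrand on its whole domain\<close>

text \<open>An instance of the convexity inequality involves only three points, so approximation by
  convex functions at three points at a time is enough.\<close>

lemma convex_on_approx:
  fixes g :: "'a::real_vector \<Rightarrow> real"
  assumes "\<And>u v w e. 0 < e \<Longrightarrow> \<exists>h. convex_on UNIV h \<and> \<bar>h u - g u\<bar> \<le> e \<and> \<bar>h v - g v\<bar> \<le> e \<and> \<bar>h w - g w\<bar> \<le> e"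
  shows "convex_on UNIV g"
proof (rule convex_onI)
  fix t :: real and u v :: 'a
  assume t: "0 < t" "t < 1"
  define w where "w = (1 - t) *\<^sub>R u + t *\<^sub>R v"
  have "g w \<le> ((1 - t) * g u + t * g v) + e" if "0 < e" for e
  proof -
    obtain h where h: "convex_on UNIV h" "\<bar>h u - g u\<bar> \<le> e / 2" "\<bar>h v - g v\<bar> \<le> e / 2" "\<bar>h w - g w\<bar> \<le> e / 2"
      using assms[of "e / 2" u v w] \<open>0 < e\<close> by auto
    have 1: "h w \<le> (1 - t) * h u + t * h v"
      unfolding w_def using t by (intro convex_onD[OF h(1)]) auto
    have "h u \<le> g u + e / 2" "h v \<le> g v + e / 2" and 2: "g w \<le> h w + e / 2" using h by linarith+
    then have "(1 - t) * h u \<le> (1 - t) * (g u + e / 2)" "t * h v \<le> t * (g v + e / 2)"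
      using t by (auto intro!: mult_left_mono)
    moreover have "(1 - t) * (g u + e / 2) + t * (g v + e / 2) = (1 - t) * g u + t * g v + e / 2"
      by (simp add: field_simps)
    ultimately show ?thesis using 1 2 by linarith
  qed
  then show "g ((1 - t) *\<^sub>R u + t *\<^sub>R v) \<le> (1 - t) * g u + t * g v"
    unfolding w_def by (rule field_le_epsilon)
qed simp

text \<open>A nonempty open set is not negligible.\<close>

lemma AE_dense:
  fixes U :: "'a::euclidean_space set"
  assumes ae: "AE x\<in>U in lebesgue. P x" and "open U" "x \<in> U" "0 < d"
  obtains y where "y \<in> U" "norm (x - y) < d" "P y"
proof -
  have "\<exists>y\<in>U \<inter> ball x d. P y"
  proof (rule ccontr)
    assume no: "\<not> (\<exists>y\<in>U \<inter> ball x d. P y)"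
    obtain N where N: "N \<in> null_sets lebesgue" "{x. \<not> (x \<in> U \<longrightarrow> P x)} \<subseteq> N"
      using ae by (auto simp: eventually_ae_filter)
    have "U \<inter> ball x d \<subseteq> N" using no N(2) by blast
    moreover have "negligible N" using N(1) by (simp add: negligible_iff_null_sets)
    ultimately have "negligible (U \<inter> ball x d)" using negligible_subset by blast
    moreover have "x \<in> U \<inter> ball x d" using assms by simp
    moreover have "open (U \<inter> ball x d)" using assms by (intro open_Int open_ball)
    ultimately show False using open_not_negligible by blast
  qed
  then show thesis using that by (auto simp: dist_norm)
qed

text \<open>For |x| > 1 the unit vector x / |x| lies on the segment from 0 to x, so the lower bound
  on the unit ball propagates linearly.\<close>

lemma convex_lower_linear:
  fixes g :: "'a::real_normed_vector \<Rightarrow> real"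
  assumes g: "convex_on UNIV g" and B: "0 \<le> B" "g 0 \<le> B" "\<And>x. norm x \<le> 1 \<Longrightarrow> - B \<le> g x"
  shows "- (2 * B) * (1 + norm x) \<le> g x"
proof (cases "norm x \<le> 1")
  case True
  have "0 \<le> 2 * B * norm x" using B(1) by simp
  moreover have "- (2 * B) * (1 + norm x) = - 2 * B - 2 * B * norm x" by (simp add: algebra_simps)
  ultimately show ?thesis using B(3)[OF True] B(1) by linarith
next
  case False
  define r where "r = norm x"
  have r: "1 < r" using False by (simp add: r_def)
  have "g ((1 - 1 / r) *\<^sub>R 0 + (1 / r) *\<^sub>R x) \<le> (1 - 1 / r) * g 0 + 1 / r * g x"
    using r by (intro convex_onD[OF g]) auto
  moreover have "- B \<le> g ((1 / r) *\<^sub>R x)" using r by (intro B(3)) (simp add: r_def)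
  moreover have "(1 - 1 / r) * g 0 \<le> (1 - 1 / r) * B" using r B by (intro mult_left_mono) auto
  ultimately have "- B - (1 - 1 / r) * B \<le> 1 / r * g x" by simp
  then have "r * (- B - (1 - 1 / r) * B) \<le> r * (1 / r * g x)" using r by (intro mult_left_mono) auto
  then have "- (2 * B * r) + B \<le> g x" using r by (simp add: algebra_simps)
  then show ?thesis using B(1) by (simp add: r_def algebra_simps)
qed

text \<open>The pointwise conditions hold almost everywhere only; by continuity in the space variable their
  integrated forms hold everywhere.\<close>

lemma integrand_convexity:
  fixes \<Omega> :: "(real^'n) set"
  assumes "open \<Omega>" and p: "1 < p" and q: "1 < q" and m: "0 \<le> m" and M: "0 \<le> M" and H: "0 < H"
    and h1: "H1 \<Omega> f" and h2: "H2 p m \<Omega> f" and h3: "H3 q M \<Omega> f" and h6: "H6 q H \<Omega> f" and x: "x \<in> \<Omega>"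
  shows "convex_on UNIV (\<lambda>\<xi>. f x \<xi> - m / wt_hi p * wt p \<xi>)"
    and "convex_on UNIV (\<lambda>\<xi>. M / wt_lo q * wt q \<xi> - f x \<xi>)"
proof -
  define Good where "Good = (\<lambda>y. convex_on UNIV (\<lambda>\<xi>. f y \<xi> - m / wt_hi p * wt p \<xi>) \<and>
    convex_on UNIV (\<lambda>\<xi>. M / wt_lo q * wt q \<xi> - f y \<xi>))"
  have "AE y\<in>\<Omega> in lebesgue. Good y"
    using h1[unfolded H1_def] h2[unfolded H2_def] h3[unfolded H3_def]
  proof eventually_elim
    case (elim y)
    show ?case
    proof
      assume "y \<in> \<Omega>"
      then have C2: "C2 (f y)"
        and lo: "\<And>\<xi> v. m * wt (p - 2) \<xi> * (norm v)\<^sup>2 \<le> hess_form (f y) v \<xi>"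
        and hi: "\<And>\<xi>. norm (\<chi> i j. partial j (partial i (f y)) \<xi>) \<le> M * wt (q - 2) \<xi>"
        using elim unfolding hess_form_def hessian_xi_def wt_def by auto
      have "hess_form (f y) v \<xi> \<le> M * wt (q - 2) \<xi> * (norm v)\<^sup>2" for \<xi> v
        using hess_form_le_norm_hessian[of "f y" v \<xi>] mult_right_mono[OF hi[of \<xi>], of "(norm v)\<^sup>2"] by simp
      then show "Good y"
        unfolding Good_def using C2 lo wt_hi_pos[OF p] wt_lo_pos[OF q] m M p q
        by (intro conjI convex_on_minus_wt convex_on_wt_minus) auto
    qed
  qed
  then have near: "\<exists>y. Good y \<and> (\<forall>\<xi>\<in>{u, v, w}. \<bar>f y \<xi> - f x \<xi>\<bar> \<le> e)" if e0: "0 < e" for u v w and e :: real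
  proof -
    \<comment> \<open>\<open>K\<close> dominates the weight at each of the three points, so one y
      closer to x than e / (H K) serves all of them in (H6).\<close>
    define K where "K = wt q u + wt q v + wt q w"
    have K: "0 < K" by (simp add: K_def add_pos_pos wt_pos)
    obtain y where y: "y \<in> \<Omega>" "norm (x - y) < e / (H * K)" "Good y"
      by (rule AE_dense[OF \<open>AE y\<in>\<Omega> in lebesgue. Good y\<close> \<open>open \<Omega>\<close> x, of "e / (H * K)"])
        (use e0 H K in auto)
    have "\<bar>f y \<xi> - f x \<xi>\<bar> \<le> e" if "\<xi> \<in> {u, v, w}" for \<xi>
    proof -
      have "\<bar>f y \<xi> - f x \<xi>\<bar> \<le> H * norm (x - y) * wt q \<xi>"
        using h6 x y(1) unfolding H6_def wt_def by (metis abs_minus_commute)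
      also have "\<dots> \<le> H * norm (x - y) * K"
        using that H less_imp_le[OF wt_pos[of q u]] less_imp_le[OF wt_pos[of q v]] less_imp_le[OF wt_pos[of q w]]
        by (intro mult_left_mono) (auto simp: K_def)
      also have "\<dots> \<le> e" using y(2) H K by (simp add: field_simps)
      finally show ?thesis .
    qed
    with y show ?thesis by blast
  qed
  show "convex_on UNIV (\<lambda>\<xi>. f x \<xi> - m / wt_hi p * wt p \<xi>)"
  proof (rule convex_on_approx)
    fix u v w and e :: real assume "0 < e"
    from near[OF this, of u v w] obtain y where "Good y" "\<forall>\<xi>\<in>{u, v, w}. \<bar>f y \<xi> - f x \<xi>\<bar> \<le> e" by blast
    then show "\<exists>h. convex_on UNIV h \<and> \<bar>h u - (f x u - m / wt_hi p * wt p u)\<bar> \<le> e \<and>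
        \<bar>h v - (f x v - m / wt_hi p * wt p v)\<bar> \<le> e \<and> \<bar>h w - (f x w - m / wt_hi p * wt p w)\<bar> \<le> e"
      by (intro exI[of _ "\<lambda>\<xi>. f y \<xi> - m / wt_hi p * wt p \<xi>"]) (auto simp: Good_def)
  qed
  show "convex_on UNIV (\<lambda>\<xi>. M / wt_lo q * wt q \<xi> - f x \<xi>)"
  proof (rule convex_on_approx)
    fix u v w and e :: real assume "0 < e"
    from near[OF this, of u v w] obtain y where "Good y" "\<forall>\<xi>\<in>{u, v, w}. \<bar>f y \<xi> - f x \<xi>\<bar> \<le> e" by blast
    then show "\<exists>h. convex_on UNIV h \<and> \<bar>h u - (M / wt_lo q * wt q u - f x u)\<bar> \<le> e \<and>
        \<bar>h v - (M / wt_lo q * wt q v - f x v)\<bar> \<le> e \<and> \<bar>h w - (M / wt_lo q * wt q w - f x w)\<bar> \<le> e"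
      by (intro exI[of _ "\<lambda>\<xi>. M / wt_lo q * wt q \<xi> - f y \<xi>"]) (auto simp: Good_def abs_minus_commute)
  qed
qed

text \<open>With k half of the constant allowed by (H2), f - k w is the convex function f - 2 k w,
  bounded below linearly, plus k w. This gives the coercivity. All constants have to be independent
  of x.\<close>

lemma integrand_coercive_convex:
  fixes \<Omega> :: "(real^'n) set"
  assumes "open \<Omega>" and bdd: "bounded \<Omega>" and p: "1 < p" and pq: "p < q"
    and m: "0 < m" and M: "0 < M" and H: "0 < H" and nonneg: "\<forall>x\<in>\<Omega>. \<forall>\<xi>. 0 \<le> f x \<xi>"
    and h1: "H1 \<Omega> f" and h2: "H2 p m \<Omega> f" and h3: "H3 q M \<Omega> f" and h6: "H6 q H \<Omega> f"
  shows "\<exists>k>0. \<exists>C0 C1. \<forall>x\<in>\<Omega>. coercive_convex_vec (\<lambda>\<xi>. f x \<xi> - k * wt p \<xi>) p q k C0 C1"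
proof (cases "\<Omega> = {}")
  case True
  then show ?thesis by (intro exI[of _ 1]) simp
next
  case False
  then obtain x1 where x1: "x1 \<in> \<Omega>" by blast
  have q: "1 < q" using p pq by simp
  obtain D where D: "\<And>x. x \<in> \<Omega> \<Longrightarrow> norm (x - x1) \<le> D" "0 < D"
  proof -
    obtain D where "\<And>x. x \<in> \<Omega> \<Longrightarrow> norm x \<le> D" "0 < D" using bdd by (auto simp: bounded_pos)
    then have "norm (x - x1) \<le> D + D" if "x \<in> \<Omega>" for x
      using norm_triangle_ineq4[of x x1] that x1 by (meson add_mono order_trans)
    then show thesis using that[of "D + D"] \<open>0 < D\<close> by simp
  qed
  define k where "k = m / wt_hi p / 2"
  define C1 where "C1 = M / wt_lo q"
  have k: "0 < k" and C1: "0 < C1"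
    using m M wt_hi_pos[OF p] wt_lo_pos[OF q] by (auto simp: k_def C1_def)
  have conv: "convex_on UNIV (\<lambda>\<xi>. f x \<xi> - 2 * k * wt p \<xi>)" "convex_on UNIV (\<lambda>\<xi>. C1 * wt q \<xi> - f x \<xi>)" if "x \<in> \<Omega>" for x
    using integrand_convexity[OF \<open>open \<Omega>\<close> p q _ _ H h1 h2 h3 h6 that] m M by (auto simp: k_def C1_def)
  \<comment> \<open>The upper growth of f is established at the single point \<open>x1\<close>, by a
    linear lower bound for the convex function C1 w_q - f(x1, .) with w_q = \<open>wt q\<close>, and
    carried to the other points by (H6) and the boundedness of the domain.\<close>
  obtain A where A: "0 \<le> A" "\<And>\<xi>. C1 * wt q \<xi> - f x1 \<xi> \<ge> - (2 * A) * (1 + norm \<xi>)"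
  proof -
    define g where "g = (\<lambda>\<xi>. C1 * wt q \<xi> - f x1 \<xi>)"
    have g: "convex_on UNIV g" unfolding g_def by (rule conv(2)[OF x1])
    have "continuous_on (cball 0 1) g"
      using convex_on_continuous[OF open_UNIV g] continuous_on_subset by blast
    then have "bounded (g ` cball 0 1)"
      by (intro compact_imp_bounded compact_continuous_image) auto
    then obtain B where "\<forall>z\<in>g ` cball 0 1. norm z \<le> B"
      unfolding bounded_iff by blast
    then have B: "\<bar>g \<xi>\<bar> \<le> B" if "norm \<xi> \<le> 1" for \<xi>
      using that by auto
    have B0: "\<bar>g 0\<bar> \<le> B" by (rule B) simp
    show thesis
    proof (rule that)
      show "0 \<le> B" using B0 by linarith
      have "- (2 * B) * (1 + norm \<xi>) \<le> g \<xi>" for \<xi>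
      proof (rule convex_lower_linear[OF g])
        show "0 \<le> B" "g 0 \<le> B" using B0 by linarith+
        show "- B \<le> g \<xi>" if "norm \<xi> \<le> 1" for \<xi> using B[OF that] by linarith
      qed
      then show "- (2 * B) * (1 + norm \<xi>) \<le> C1 * wt q \<xi> - f x1 \<xi>" for \<xi> by (simp add: g_def)
    qed
  qed
  define C where "C = C1 + 4 * A + H * D"
  have C: "0 \<le> C" using A C1 H D by (simp add: C_def)
  have upper: "f x \<xi> \<le> C * wt q \<xi>" if x: "x \<in> \<Omega>" for x \<xi>
  proof -
    have "\<bar>f x \<xi> - f x1 \<xi>\<bar> \<le> H * norm (x - x1) * wt q \<xi>"
      using h6 x x1 unfolding H6_def wt_def by blast
    also have "\<dots> \<le> H * D * wt q \<xi>"
      using H D(1)[OF x] wt_pos[of q \<xi>] by (intro mult_right_mono mult_left_mono) auto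
    finally have "f x \<xi> \<le> C1 * wt q \<xi> + 2 * A * (1 + norm \<xi>) + H * D * wt q \<xi>"
      using A(2)[of \<xi>] by (simp add: abs_le_iff algebra_simps)
    also have "2 * A * (1 + norm \<xi>) \<le> 2 * A * (wt q \<xi> + wt q \<xi>)"
      using A q by (intro mult_left_mono add_mono wt_ge_1 norm_le_wt) auto
    finally show ?thesis by (simp add: C_def algebra_simps)
  qed
  \<comment> \<open>Bounds f(x, 0) - 2 k from above by C, and, since f >= 0, f - 2 k w from below on
    the unit ball, where w <= 2^(p/2).\<close>
  define B where "B = C + 2 * k * 2 powr (p / 2)"
  have B: "0 \<le> B" using C k by (simp add: B_def)
  define C0 where "C0 = C + 2 * B"
  have "coercive_convex_vec (\<lambda>\<xi>. f x \<xi> - k * wt p \<xi>) p q k C0 C1" if x: "x \<in> \<Omega>" for x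
  proof
    show "1 < p" "1 < q" "0 < k" "0 \<le> C0" "0 \<le> C1" "p \<le> q"
      using p q pq k C1 C B by (auto simp: C0_def)
    have "convex_on UNIV (\<lambda>\<xi>. (f x \<xi> - 2 * k * wt p \<xi>) + k * wt p \<xi>)"
      using k by (intro convex_on_add convex_on_cmul conv(1)[OF x] convex_on_wt p) auto
    then show "convex_on UNIV (\<lambda>\<xi>. f x \<xi> - k * wt p \<xi>)"
      by (simp add: algebra_simps)
    have "convex_on UNIV (\<lambda>\<xi>. (C1 * wt q \<xi> - f x \<xi>) + k * wt p \<xi>)"
      using k by (intro convex_on_add convex_on_cmul conv(2)[OF x] convex_on_wt p) auto
    then show "convex_on UNIV (\<lambda>\<xi>. C1 * wt q \<xi> - (f x \<xi> - k * wt p \<xi>))"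
      by (simp add: algebra_simps)
    fix \<xi> :: "real^'n"
    have "C * wt q \<xi> \<le> C0 * wt q \<xi>"
      using B wt_pos[of q \<xi>] by (intro mult_right_mono) (auto simp: C0_def)
    then show "f x \<xi> - k * wt p \<xi> \<le> C0 * wt q \<xi>"
      using upper[OF x, of \<xi>] k wt_pos[of p \<xi>] by (smt (verit) mult_pos_pos)
    have "- (2 * B) * (1 + norm \<xi>) \<le> f x \<xi> - 2 * k * wt p \<xi>"
    proof (rule convex_lower_linear[OF conv(1)[OF x] B])
      show "f x 0 - 2 * k * wt p 0 \<le> B"
        using upper[OF x, of 0] k by (simp add: B_def wt_def add_increasing2)
      fix \<eta> :: "real^'n" assume "norm \<eta> \<le> 1"
      then have "wt p \<eta> \<le> 2 powr (p / 2)"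
        unfolding wt_def using p by (intro powr_mono2) (auto simp: power_le_one)
      then have "2 * k * wt p \<eta> \<le> 2 * k * 2 powr (p / 2)" using k by simp
      then show "- B \<le> f x \<eta> - 2 * k * wt p \<eta>"
        using nonneg x C unfolding B_def by (smt (verit))
    qed
    moreover have "2 * B * (1 + norm \<xi>) \<le> C0 * (1 + norm \<xi>)"
      using C by (intro mult_right_mono) (auto simp: C0_def)
    ultimately show "k * wt p \<xi> - C0 * (1 + norm \<xi>) \<le> f x \<xi> - k * wt p \<xi>" by simp
  qed
  with k show ?thesis by blast
qed

subsection \<open>Piecewise constant dependence on the space variable\<close>

definition admissible :: "real \<Rightarrow> real \<Rightarrow> real \<Rightarrow> real \<Rightarrow> (real^'n \<Rightarrow> real) \<Rightarrow> bool" where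
  "admissible p q m M g \<longleftrightarrow> C2 g \<and> strictly_convex g \<and> (\<forall>\<xi>. 0 \<le> g \<xi>) \<and>
     (\<forall>\<xi> v. m * wt (p - 2) \<xi> * (norm v)\<^sup>2 \<le> hess_form g v \<xi>) \<and>
     (\<forall>\<xi>. norm (\<chi> i j. partial j (partial i g) \<xi>) \<le> M * wt (q - 2) \<xi>)"

text \<open>Two-sided control is possible only for |\<xi>| <= T, since a truncation may lie far
  below f beyond. The upper bound for all \<xi> is what provides a dominating function.\<close>

definition approximates :: "real \<Rightarrow> real \<Rightarrow> real \<Rightarrow> (real^'n \<Rightarrow> real) \<Rightarrow> (real^'n \<Rightarrow> real) \<Rightarrow> bool" where
  "approximates p \<epsilon> T f g \<longleftrightarrow> (\<forall>\<xi>. g \<xi> \<le> f \<xi> + \<epsilon> * wt p \<xi>) \<and>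
     (\<forall>\<xi>. norm \<xi> \<le> T \<longrightarrow> \<bar>g \<xi> - f \<xi>\<bar> \<le> \<epsilon> * wt p \<xi>)"

text \<open>The order of quantifiers carries the content: m, M and K are fixed before the accuracy
  \<epsilon> and the radius T, whereas the mesh \<delta> and the functions G depend on both.\<close>

lemma regularization_exists:
  fixes \<Omega> :: "(real^'n) set"
  assumes k: "0 < k" and p: "1 < p" and q: "1 < q" and H: "0 < H"
    and all_cc: "\<forall>x\<in>\<Omega>. coercive_convex_vec (\<lambda>\<xi>. f x \<xi> - k * wt p \<xi>) p q k C0 C1"
    and nonneg: "\<forall>x\<in>\<Omega>. \<forall>\<xi>. 0 \<le> f x \<xi>" and h6: "H6 q H \<Omega> f" and x1: "x1 \<in> \<Omega>"
  shows "\<exists>m>0. \<exists>M>0. \<exists>K>0. \<forall>\<epsilon>>0. \<forall>T. \<exists>\<delta>>0. \<exists>G. (\<forall>c\<in>\<Omega>. admissible p q m M (G c)) \<and>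
      (\<forall>c\<in>\<Omega>. \<forall>x\<in>\<Omega>. norm (x - c) < \<delta> \<longrightarrow> approximates p (\<epsilon> * K) T (f x) (G c))"
proof -
  note cc = bspec[OF all_cc]
  \<comment> \<open>Serves to name the constants; those of the interpretations at other points are
    the same terms.\<close>
  interpret x1: coercive_convex_vec "\<lambda>\<xi>. f x1 \<xi> - k * wt p \<xi>" p q k C0 C1
    by (rule cc[OF x1])
  define K where "K = k * (p * 3 powr (p / 2)) + 2"
  have K: "0 < K" using k p by (simp add: K_def add_pos_pos)
  define M where "M = (real CARD('n))\<^sup>2 * x1.growth_const"
  have M: "0 < M" using x1.growth_const_pos by (simp add: M_def)
  have "\<exists>\<delta>>0. \<exists>G. (\<forall>c\<in>\<Omega>. admissible p q x1.ell_const M (G c)) \<and>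
      (\<forall>c\<in>\<Omega>. \<forall>x\<in>\<Omega>. norm (x - c) < \<delta> \<longrightarrow> approximates p (\<epsilon> * K) T (f x) (G c))"
    if \<epsilon>: "0 < \<epsilon>" for \<epsilon> T
  proof -
    \<comment> \<open>Beyond T, the radius must satisfy k T' >= \<open>lower\<close>, which yields
      nonnegativity. \<open>L\<close> then makes the envelope exact up to radius T', and
      \<open>e\<close> is chosen so that the total reach 2 n e of the averages is d.\<close>
    define T' where "T' = max T (x1.lower / k)"
    define L where "L = \<bar>x1.slope_const T'\<bar>"
    define d where "d = min 1 (\<epsilon> / (L + 1))"
    define e where "e = d / (2 * real CARD('n))"
    \<comment> \<open>All envelope minimisers for slope L lie within radius R, where
      \<open>wt q\<close> is at most \<open>w\<close>; hence points at distance below \<delta>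
      change the envelope by at most H \<delta> w = \<epsilon>.\<close>
    define R where "R = coercive_radius p k (2 * C0) (C0 + L)"
    define w where "w = (1 + R\<^sup>2) powr (q / 2)"
    define \<delta> where "\<delta> = \<epsilon> / (H * w)"
    define a where "a = (\<lambda>c \<xi>. f c \<xi> - k * wt p \<xi>)"
    define G where "G = (\<lambda>c. mollify e (truncation p k L (a c)))"
    have L: "0 \<le> L" "x1.slope_const T' \<le> L" by (auto simp: L_def)
    have T': "T \<le> T'" "x1.lower \<le> k * T'"
      using k by (auto simp: T'_def max_def field_simps)
    have d: "0 < d" "d \<le> 1" using \<epsilon> L by (auto simp: d_def)
    have dL: "d * (L + 1) \<le> \<epsilon>"
    proof -
      have "d * (L + 1) \<le> \<epsilon> / (L + 1) * (L + 1)" using L by (intro mult_right_mono) (auto simp: d_def)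
      then show ?thesis using L by simp
    qed
    have ed: "e * (2 * real CARD('n)) = d" and e: "0 < e" using d by (auto simp: e_def)
    have w: "0 < w" using one_plus_norm_sq_pos[of R] by (simp add: w_def)
    have \<delta>: "0 < \<delta>" using \<epsilon> H w by (simp add: \<delta>_def)
    have props: "admissible p q x1.ell_const M (G c)"
      if c: "c \<in> \<Omega>" for c
    proof -
      interpret c: coercive_convex_vec "a c" p q k C0 C1
        unfolding a_def by (rule cc[OF c])
      have e1: "e * (2 * real CARD('n)) \<le> 1" using d by (simp add: ed)
      have "0 \<le> truncation p k L (a c) \<xi>" for \<xi>
        using nonneg c L T' by (intro c.truncation_nonneg[of L T']) (auto simp: a_def)
      then show ?thesis
        unfolding G_def admissible_def M_def
        by (intro conjI allI c.C2_regularized[OF L(1) e e1] c.strictly_convex_regularized[OF L(1) e e1]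
          c.regularized_nonneg[OF L(1) e e1] c.hess_form_regularized_bounds(1)[OF L(1) e e1]
          c.norm_hessian_regularized_le[OF L(1) e e1])
    qed
    have close: "approximates p (\<epsilon> * K) T (f x) (G c)"
      if c: "c \<in> \<Omega>" and x: "x \<in> \<Omega>" and xc: "norm (x - c) < \<delta>" for c x
    proof -
      interpret c: coercive_convex_vec "a c" p q k C0 C1
        unfolding a_def by (rule cc[OF c])
      interpret x: coercive_convex_vec "a x" p q k C0 C1
        unfolding a_def by (rule cc[OF x])
      have "\<bar>envelope L (a c) \<xi> - envelope L (a x) \<xi>\<bar> \<le> \<epsilon>" for \<xi>
      proof (rule envelope_diff_le[OF c.coercive_convex_axioms x.coercive_convex_axioms L(1)])
        fix \<eta> :: "real^'n" assume "norm \<eta> \<le> coercive_radius p k (2 * C0) (C0 + L)"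
        then have "wt q \<eta> \<le> w"
          unfolding wt_def w_def R_def using q by (intro powr_mono2 add_left_mono power_mono) auto
        have "\<bar>a c \<eta> - a x \<eta>\<bar> = \<bar>f x \<eta> - f c \<eta>\<bar>" by (simp add: a_def)
        also have "\<dots> \<le> H * norm (x - c) * wt q \<eta>"
          using h6 x c unfolding H6_def wt_def by blast
        also have "\<dots> \<le> H * \<delta> * w"
          using H xc \<open>wt q \<eta> \<le> w\<close> wt_pos[of q \<eta>] \<delta> by (intro mult_mono) auto
        also have "\<dots> = \<epsilon>" using H w by (simp add: \<delta>_def)
        finally show "\<bar>a c \<eta> - a x \<eta>\<bar> \<le> \<epsilon>" .
      qed
      then have 1: "\<bar>truncation p k L (a c) \<xi> - truncation p k L (a x) \<xi>\<bar> \<le> \<epsilon> * wt p \<xi>" for \<xi>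
        using mult_left_mono[OF wt_ge_1[of p \<xi>], of \<epsilon>] \<epsilon> p unfolding truncation_def
        by (smt (verit) mult_cancel_left1)
      have "e * (2 * real CARD('n)) \<le> 1" using d by (simp add: ed)
      have 2: "\<bar>G c \<xi> - truncation p k L (a c) \<xi>\<bar> \<le> \<epsilon> * (K - 1) * wt p \<xi>" for \<xi>
      proof -
        have "K - 1 = k * (p * 3 powr (p / 2)) + 1" by (simp add: K_def)
        then show ?thesis using c.regularized_close[OF L(1) e \<open>e * (2 * real CARD('n)) \<le> 1\<close>] dL
          unfolding G_def ed by metis
      qed
      \<comment> \<open>The share K - 1 pays for mollification, the remaining 1 for freezing x at
        c.\<close>
      have split: "\<epsilon> * K * wt p \<xi> = \<epsilon> * (K - 1) * wt p \<xi> + \<epsilon> * wt p \<xi>" for \<xi> :: "real^'n"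
        by (simp add: algebra_simps)
      have 3: "\<bar>G c \<xi> - truncation p k L (a x) \<xi>\<bar> \<le> \<epsilon> * K * wt p \<xi>" for \<xi>
        using 1[of \<xi>] 2[of \<xi>] unfolding split by linarith
      have "truncation p k L (a x) \<xi> \<le> f x \<xi>" for \<xi>
        using x.truncation_le[OF L(1), of \<xi>] by (simp add: a_def)
      moreover have "truncation p k L (a x) \<xi> = f x \<xi>" if "norm \<xi> \<le> T" for \<xi>
        using x.truncation_eq[of \<xi> T' L] that T' L by (simp add: a_def)
      ultimately show ?thesis using 3 unfolding approximates_def by (smt (verit))
    qed
    show ?thesis using \<delta> props close by blast
  qed
  then show ?thesis using x1.ell_const_pos M K by blast
qed

text \<open>A partition into pieces of radius \<delta> around finitely many centres. Local constancy
  of the index almost everywhere kills the x-derivatives, and the Borel pieces keep the integrands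
  measurable.\<close>

definition ball_index :: "'a::euclidean_space set \<Rightarrow> real \<Rightarrow> nat \<Rightarrow> (nat \<Rightarrow> 'a) \<Rightarrow> ('a \<Rightarrow> nat) \<Rightarrow> bool" where
  "ball_index B \<delta> N c idx \<longleftrightarrow> 0 < N \<and> (\<forall>i\<in>{1..N}. c i \<in> closure B) \<and>
     (\<forall>x\<in>B. idx x \<in> {1..N} \<and> norm (x - c (idx x)) < \<delta>) \<and>
     (AE x\<in>B in lebesgue. \<forall>\<^sub>F y in nhds x. idx y = idx x) \<and> (\<forall>i. {x\<in>B. idx x = i} \<in> sets borel)"

text \<open>Cover the compact closure by finitely many balls and send x to the least index of a ball
  containing it. The index can change only across the bounding spheres, a null set.\<close>

lemma finite_ball_index:
  fixes B :: "'a::euclidean_space set"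
  assumes K: "compact (closure B)" and "B \<noteq> {}" and \<delta>: "0 < \<delta>" and B: "B \<in> sets borel"
  shows "\<exists>N c idx. ball_index B \<delta> N c idx"
proof -
  have "closure B \<subseteq> (\<Union>x\<in>closure B. ball x \<delta>)" using \<delta> by force
  then obtain D where D: "D \<subseteq> closure B" "finite D" "closure B \<subseteq> (\<Union>x\<in>D. ball x \<delta>)"
    using compactE_image[OF K, of "closure B" "\<lambda>x. ball x \<delta>"] open_ball by metis
  obtain c where c: "bij_betw c {1..card D} D"
    using ex_bij_betw_nat_finite_1[OF D(2)] by blast
  define N where "N = card D"
  define P where "P = (\<lambda>x i. i \<in> {1..N} \<and> x \<in> ball (c i) \<delta>)"
  define idx where "idx = (\<lambda>x. LEAST i. P x i)"
  have "D \<noteq> {}" using D(3) \<open>B \<noteq> {}\<close> closure_subset[of B] by auto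
  then have N: "0 < N" using D(2) by (simp add: N_def card_gt_0_iff)
  have cD: "c ` {1..N} = D" using c by (simp add: bij_betw_def N_def)
  have ex: "\<exists>i. P x i" if "x \<in> B" for x
  proof -
    have "x \<in> closure B" using that closure_subset by blast
    then obtain z where "z \<in> c ` {1..N}" "x \<in> ball z \<delta>" using D(3) unfolding cD by blast
    then show ?thesis unfolding P_def by blast
  qed
  have idx: "P x (idx x)" if "x \<in> B" for x
    unfolding idx_def using ex[OF that] by (rule LeastI_ex)
  have "negligible (\<Union>i\<in>{1..N}. sphere (c i) \<delta>)"
    by (intro negligible_Union) (auto intro: negligible_sphere)
  then have null: "(\<Union>i\<in>{1..N}. sphere (c i) \<delta>) \<in> null_sets lebesgue"
    by (simp add: negligible_iff_null_sets)
  have loc: "\<forall>\<^sub>F y in nhds x. idx y = idx x" if x: "x \<notin> (\<Union>i\<in>{1..N}. sphere (c i) \<delta>)" for x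
  proof -
    have "\<forall>\<^sub>F y in nhds x. (y \<in> ball (c i) \<delta>) = (x \<in> ball (c i) \<delta>)" if "i \<in> {1..N}" for i
    proof (cases "x \<in> ball (c i) \<delta>")
      case True
      then show ?thesis using eventually_nhds_in_open[OF open_ball True] by (auto elim: eventually_mono)
    next
      case False
      then have "x \<in> - cball (c i) \<delta>" using x that by (force simp: sphere_def)
      from eventually_nhds_in_open[OF _ this] have "\<forall>\<^sub>F y in nhds x. y \<in> - cball (c i) \<delta>" by auto
      then show ?thesis using False by (auto elim!: eventually_mono)
    qed
    then have "\<forall>\<^sub>F y in nhds x. \<forall>i\<in>{1..N}. (y \<in> ball (c i) \<delta>) = (x \<in> ball (c i) \<delta>)"
      by (intro eventually_ball_finite) auto
    then show ?thesis
    proof eventually_elim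
      case (elim y)
      \<comment> \<open>Equal predicates have equal \<open>LEAST\<close>, so this works for y
        outside B as well.\<close>
      then have "P y = P x" by (auto simp: P_def fun_eq_iff)
      then show ?case by (simp add: idx_def)
    qed
  qed
  have "ball_index B \<delta> N c idx"
    unfolding ball_index_def
  proof (intro conjI ballI allI N)
    show "c i \<in> closure B" if "i \<in> {1..N}" for i using that cD D(1) by blast
    show "idx x \<in> {1..N}" "norm (x - c (idx x)) < \<delta>" if "x \<in> B" for x
      using idx[OF that] by (simp_all add: P_def dist_norm norm_minus_commute)
    show "AE x\<in>B in lebesgue. \<forall>\<^sub>F y in nhds x. idx y = idx x"
      using loc by (intro AE_I'[OF null]) blast
    fix i
    have "{x\<in>B. idx x = i} = (if i \<in> {1..N} then (B \<inter> ball (c i) \<delta>) - (\<Union>j\<in>{1..<i}. ball (c j) \<delta>) else {})"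
    proof (cases "i \<in> {1..N}")
      case True
      have "idx x = i \<longleftrightarrow> x \<in> ball (c i) \<delta> \<and> (\<forall>j\<in>{1..<i}. x \<notin> ball (c j) \<delta>)" if "x \<in> B" for x
      proof
        assume i: "idx x = i"
        have "\<not> P x j" if "j < i" for j using not_less_Least[of j "P x"] that i by (simp add: idx_def)
        then show "x \<in> ball (c i) \<delta> \<and> (\<forall>j\<in>{1..<i}. x \<notin> ball (c j) \<delta>)"
          using idx[OF that] i True by (auto simp: P_def)
      next
        assume "x \<in> ball (c i) \<delta> \<and> (\<forall>j\<in>{1..<i}. x \<notin> ball (c j) \<delta>)"
        then show "idx x = i"
          unfolding idx_def using True by (intro Least_equality) (auto simp: P_def not_less[symmetric])
      qed
      then have "{x\<in>B. idx x = i} = (B \<inter> ball (c i) \<delta>) - (\<Union>j\<in>{1..<i}. ball (c j) \<delta>)" by blast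
      then show ?thesis using True by simp
    next
      case False
      then show ?thesis using idx by (auto simp: P_def)
    qed
    then show "{x\<in>B. idx x = i} \<in> sets borel" using B by simp
  qed
  then show ?thesis by blast
qed

lemma locally_constant_mixed_derivative:
  fixes F :: "real^'n \<Rightarrow> real^'n \<Rightarrow> real"
  assumes ev: "\<forall>\<^sub>F y in nhds x. F y = F x" and C2: "C2 (F x)"
  shows "has_mixed_xi_x F x \<xi>" and "mixed_xi_x F x \<xi> = 0"
proof -
  have line: "\<forall>\<^sub>F t in nhds (0::real). F (x + t *\<^sub>R axis j 1) = F x" for j
  proof -
    have "((\<lambda>t::real. x + t *\<^sub>R axis j 1) \<longlongrightarrow> x + 0 *\<^sub>R axis j 1) (nhds 0)"
      by (intro tendsto_intros filterlim_ident)
    then have "filterlim (\<lambda>t::real. x + t *\<^sub>R axis j 1) (nhds x) (nhds 0)" by simp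
    then show ?thesis using ev by (rule eventually_compose_filterlim[rotated])
  qed
  have D: "((\<lambda>t. partial i (F (x + t *\<^sub>R axis j 1)) \<xi>) has_real_derivative 0) (at 0)" for i j
  proof -
    have "((\<lambda>t::real. partial i (F x) \<xi>) has_real_derivative 0) (at 0)" by simp
    then show ?thesis
      by (subst DERIV_cong_ev[OF refl _ refl, where g = "\<lambda>t. partial i (F x) \<xi>"])
        (use line[of j] in \<open>auto elim: eventually_mono\<close>)
  qed
  show "has_mixed_xi_x F x \<xi>"
    unfolding has_mixed_xi_x_def
  proof (intro allI conjI)
    fix i j
    show "\<forall>\<^sub>F t in nhds 0. has_partial i (F (x + t *\<^sub>R axis j 1)) \<xi>"
      using line[of j] C2 by (auto elim!: eventually_mono simp: C2_def)
    show "has_partial j (\<lambda>y. partial i (F y) \<xi>) x" by (rule has_partialI(1)[OF D])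
  qed
  have "partial j (\<lambda>y. partial i (F y) \<xi>) x = 0" for i j by (rule has_partialI(2)[OF D])
  then show "mixed_xi_x F x \<xi> = 0" by (simp add: mixed_xi_x_def vec_eq_iff)
qed

section \<open>Measurability and passage to the limit in the integrals\<close>

lemma measurable_piecewise_composition:
  fixes D :: "real^'n \<Rightarrow> real^'n" and g :: "nat \<Rightarrow> real^'n \<Rightarrow> real"
  assumes D: "set_borel_measurable lebesgue B D" and g: "\<And>i. i \<in> {1..N} \<Longrightarrow> continuous_on UNIV (g i)"
    and idx: "\<And>x. x \<in> B \<Longrightarrow> idx x \<in> {1..N}" and sets: "\<And>i. {x\<in>B. idx x = i} \<in> sets borel"
  shows "(\<lambda>x. indicator B x *\<^sub>R g (idx x) (D x)) \<in> borel_measurable lebesgue"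
proof -
  \<comment> \<open>D is known to be measurable only after extension by zero off B; the outer
    indicators of the pieces hide the values of g i created there.\<close>
  have "(\<lambda>x. g i (indicator B x *\<^sub>R D x)) \<in> borel_measurable lebesgue" if "i \<in> {1..N}" for i
    using D unfolding set_borel_measurable_def
    by (rule measurable_compose) (rule borel_measurable_continuous_onI[OF g[OF that]])
  moreover have "(indicator {x\<in>B. idx x = i} :: real^'n \<Rightarrow> real) \<in> borel_measurable lebesgue" for i
    using sets[of i] by (intro borel_measurable_indicator) (simp add: sets_completionI_sets)
  ultimately have "(\<lambda>x. \<Sum>i=1..N. indicator {x\<in>B. idx x = i} x * g i (indicator B x *\<^sub>R D x)) \<in> borel_measurable lebesgue"
    by (intro borel_measurable_sum borel_measurable_times) auto
  also have "(\<lambda>x. \<Sum>i=1..N. indicator {x\<in>B. idx x = i} x * g i (indicator B x *\<^sub>R D x)) =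
      (\<lambda>x. indicator B x *\<^sub>R g (idx x) (D x))"
  proof
    fix x
    show "(\<Sum>i=1..N. indicator {x\<in>B. idx x = i} x * g i (indicator B x *\<^sub>R D x)) = indicator B x *\<^sub>R g (idx x) (D x)"
    proof (cases "x \<in> B")
      case True
      then have "(\<Sum>i=1..N. indicator {x\<in>B. idx x = i} x * g i (indicator B x *\<^sub>R D x)) =
          (\<Sum>i=1..N. if idx x = i then g i (D x) else 0)"
        by (intro sum.cong) (auto simp: indicator_def)
      then show ?thesis using idx[OF True] True by (simp add: indicator_def)
    qed simp
  qed
  finally show ?thesis .
qed

text \<open>The dominating function is f(x, Du) + K 2^(p/2) (1 + |Du|^p) on B, integrable because
  f(x, Du) and |Du|^p are and B has finite measure.\<close>

lemma dominated_growth_convergence: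
  fixes B :: "(real^'n) set" and D :: "real^'n \<Rightarrow> real^'n" and F :: "nat \<Rightarrow> real^'n \<Rightarrow> real^'n \<Rightarrow> real"
  assumes B: "B \<in> lmeasurable" and p: "1 < p" and K: "0 \<le> K"
    and D: "in_Lp p B D" and f: "set_integrable lebesgue B (\<lambda>x. f x (D x))"
    and meas: "\<And>h. (\<lambda>x. indicator B x *\<^sub>R F h x (D x)) \<in> borel_measurable lebesgue"
    and lim: "\<And>x. x \<in> B \<Longrightarrow> (\<lambda>h. F h x (D x)) \<longlonglongrightarrow> f x (D x)"
    and nonneg: "\<And>h x. x \<in> B \<Longrightarrow> 0 \<le> F h x (D x)"
    and dom: "\<And>h x. x \<in> B \<Longrightarrow> F h x (D x) \<le> f x (D x) + K * wt p (D x)"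
  shows "\<And>h. set_integrable lebesgue B (\<lambda>x. F h x (D x))"
    and "(\<lambda>h. LINT x:B|lebesgue. F h x (D x)) \<longlonglongrightarrow> (LINT x:B|lebesgue. f x (D x))"
proof -
  define w where "w = (\<lambda>x. indicator B x *\<^sub>R f x (D x) +
    K * 2 powr (p / 2) * (indicator B x + indicator B x *\<^sub>R norm (D x) powr p))"
  have w: "integrable lebesgue w"
    unfolding w_def using f D B unfolding set_integrable_def in_Lp_def
    by (intro Bochner_Integration.integrable_add integrable_mult_right integrable_real_indicator)
      (auto simp: fmeasurable_def)
  have fm: "(\<lambda>x. indicator B x *\<^sub>R f x (D x)) \<in> borel_measurable lebesgue"
    using f unfolding set_integrable_def by auto
  have conv: "AE x in lebesgue. (\<lambda>h. indicator B x *\<^sub>R F h x (D x)) \<longlonglongrightarrow> indicator B x *\<^sub>R f x (D x)"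
    using lim by (intro AE_I2) (auto simp: indicator_def)
  have bound: "AE x in lebesgue. norm (indicator B x *\<^sub>R F h x (D x)) \<le> w x" for h
  proof (intro AE_I2)
    fix x
    show "norm (indicator B x *\<^sub>R F h x (D x)) \<le> w x"
    proof (cases "x \<in> B")
      case True
      have "F h x (D x) \<le> f x (D x) + K * (2 powr (p / 2) * (1 + norm (D x) powr p))"
        using dom[OF True, of h] mult_left_mono[OF wt_le_norm_powr[of p "D x"] K] p by simp
      then show ?thesis using True nonneg[OF True, of h] by (simp add: w_def mult.assoc)
    qed (simp add: w_def)
  qed
  show "set_integrable lebesgue B (\<lambda>x. F h x (D x))" for h
    unfolding set_integrable_def by (rule integrable_dominated_convergence2[OF fm meas w conv bound])
  show "(\<lambda>h. LINT x:B|lebesgue. F h x (D x)) \<longlonglongrightarrow> (LINT x:B|lebesgue. f x (D x))"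
    unfolding set_lebesgue_integral_def by (rule integral_dominated_convergence[OF fm meas w conv bound])
qed

section \<open>Construction of the approximating sequence\<close>

theorem theorem2p1:
  fixes \<Omega> :: "(real^'n) set"
    and f :: "real^'n \<Rightarrow> real^'n \<Rightarrow> real"
    and p q m M K H :: real
  assumes "open \<Omega>" and "bounded \<Omega>" and "interior (closure \<Omega>) = \<Omega>"
    and "\<forall>x\<in>\<Omega>. \<forall>\<xi>. f x \<xi> \<ge> 0"
    and "\<forall>x\<in>\<Omega>. strictly_convex (f x)"
    and "1 < p" and "p < q"
    and "q \<le> p * ((real CARD('n) + 1) / real CARD('n))"
    and "m > 0" and "M > 0" and "K > 0" and "H > 0"
    and "H1 \<Omega> f" and "H2 p m \<Omega> f" and "H3 q M \<Omega> f" and "H4 q K \<Omega> f"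
    and "H5 \<Omega> f" and "H6 q H \<Omega> f"
  shows "\<forall>x\<^sub>0 R. R > 0 \<and> compactly_contained (ball x\<^sub>0 R) \<Omega> \<longrightarrow>
    (\<exists>fh :: nat \<Rightarrow> real^'n \<Rightarrow> real^'n \<Rightarrow> real.
       (\<forall>h. \<forall>x\<in>ball x\<^sub>0 R. \<forall>\<xi>. fh h x \<xi> \<ge> 0) \<and>
       (\<forall>h. \<exists>N>0. \<exists>(a :: nat \<Rightarrow> real^'n \<Rightarrow> real) (g :: nat \<Rightarrow> real^'n \<Rightarrow> real).
          \<forall>x\<in>ball x\<^sub>0 R. \<forall>\<xi>. fh h x \<xi> = (\<Sum>i = 1..N. a i x * g i \<xi>)) \<and>
       (\<exists>m'>0. \<exists>M'>0. \<exists>K'>0. \<forall>h.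
          H1 (ball x\<^sub>0 R) (fh h) \<and> H2 p m' (ball x\<^sub>0 R) (fh h) \<and>
          H3 q M' (ball x\<^sub>0 R) (fh h) \<and> H4 q K' (ball x\<^sub>0 R) (fh h)) \<and>
       (\<forall>h. \<forall>x\<in>ball x\<^sub>0 R. strictly_convex (fh h x)) \<and>
       (\<forall>C :: (real^'n) set. compact C \<longrightarrow>
          uniform_limit (ball x\<^sub>0 R \<times> C) (\<lambda>h (x, \<xi>). fh h x \<xi>) (\<lambda>(x, \<xi>). f x \<xi>) sequentially) \<and>
       (\<exists>r :: nat \<Rightarrow> nat. strict_mono r \<and>
          (\<forall>u Du. W1p_with_gradient p (ball x\<^sub>0 R) u Du \<and>
                  set_integrable lebesgue (ball x\<^sub>0 R) (\<lambda>x. f x (Du x)) \<longrightarrow>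
             (\<forall>\<^sub>F k in sequentially.
                set_integrable lebesgue (ball x\<^sub>0 R) (\<lambda>x. fh (r k) x (Du x))) \<and>
             (\<lambda>k. LINT x:ball x\<^sub>0 R|lebesgue. fh (r k) x (Du x))
               \<longlonglongrightarrow> (LINT x:ball x\<^sub>0 R|lebesgue. f x (Du x)))))"
proof (intro allI impI)
  fix x\<^sub>0 :: "real^'n" and R :: real
  assume "R > 0 \<and> compactly_contained (ball x\<^sub>0 R) \<Omega>"
  then have R: "0 < R" and cpt: "compact (closure (ball x\<^sub>0 R))" and sub: "closure (ball x\<^sub>0 R) \<subseteq> \<Omega>"
    by (auto simp: compactly_contained_def)
  define B where "B = ball x\<^sub>0 R"
  have B: "B \<noteq> {}" "B \<in> sets borel" "B \<in> lmeasurable" "B \<subseteq> \<Omega>"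
    using R sub closure_subset[of B] by (auto simp: B_def)
  have x0: "x\<^sub>0 \<in> \<Omega>" using B(4) R by (auto simp: B_def)
  obtain k C0 C1 where k: "0 < k"
    and cc: "\<forall>x\<in>\<Omega>. coercive_convex_vec (\<lambda>\<xi>. f x \<xi> - k * wt p \<xi>) p q k C0 C1"
    using integrand_coercive_convex[of \<Omega> p q m M H f, OF assms(1,2,6,7,9,10,12,4,13,14,15,18)] by metis
  have q: "1 < q" using assms by linarith
  from regularization_exists[where f = f and \<Omega> = \<Omega>, OF k \<open>1 < p\<close> q \<open>H > 0\<close> cc assms(4) \<open>H6 q H \<Omega> f\<close> x0]
  obtain m' M' K' where pos: "0 < m'" "0 < M'" "0 < K'" and
    ex: "\<forall>\<epsilon>>0. \<forall>T. \<exists>\<delta>>0. \<exists>G. (\<forall>c\<in>\<Omega>. admissible p q m' M' (G c)) \<and>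
      (\<forall>c\<in>\<Omega>. \<forall>x\<in>\<Omega>. norm (x - c) < \<delta> \<longrightarrow> approximates p (\<epsilon> * K') T (f x) (G c))"
    by (elim exE conjE) (rule that)
  \<comment> \<open>Accuracy 1 / (h + 1) is paired with radius T = h below, so that every compact
    set of \<xi> is eventually inside the region of two-sided control.\<close>
  define \<epsilon> where "\<epsilon> = (\<lambda>h::nat. 1 / (real h + 1))"
  have \<epsilon>: "0 < \<epsilon> h" "\<epsilon> h \<le> 1" for h by (auto simp: \<epsilon>_def)
  have "\<forall>h. \<exists>\<delta> G. 0 < \<delta> \<and> (\<forall>c\<in>\<Omega>. admissible p q m' M' (G c)) \<and>
      (\<forall>c\<in>\<Omega>. \<forall>x\<in>\<Omega>. norm (x - c) < \<delta> \<longrightarrow> approximates p (\<epsilon> h * K') (real h) (f x) (G c))"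
    using ex \<epsilon>(1) by blast
  from choice[OF this] obtain \<delta> where "\<forall>h. \<exists>G. 0 < \<delta> h \<and> (\<forall>c\<in>\<Omega>. admissible p q m' M' (G c)) \<and>
      (\<forall>c\<in>\<Omega>. \<forall>x\<in>\<Omega>. norm (x - c) < \<delta> h \<longrightarrow> approximates p (\<epsilon> h * K') (real h) (f x) (G c))" ..
  from choice[OF this] obtain G where "\<forall>h. 0 < \<delta> h \<and> (\<forall>c\<in>\<Omega>. admissible p q m' M' (G h c)) \<and>
      (\<forall>c\<in>\<Omega>. \<forall>x\<in>\<Omega>. norm (x - c) < \<delta> h \<longrightarrow> approximates p (\<epsilon> h * K') (real h) (f x) (G h c))" ..
  then have \<delta>: "0 < \<delta> h" and G: "c \<in> \<Omega> \<Longrightarrow> admissible p q m' M' (G h c)"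
    and close: "c \<in> \<Omega> \<Longrightarrow> x \<in> \<Omega> \<Longrightarrow> norm (x - c) < \<delta> h \<Longrightarrow> approximates p (\<epsilon> h * K') (real h) (f x) (G h c)"
    for h c x by blast+
  have "\<forall>h. \<exists>N c idx. ball_index B (\<delta> h) N c idx"
    using finite_ball_index[OF cpt[folded B_def] B(1) \<delta> B(2)] by blast
  then obtain N c idx where "\<And>h. ball_index B (\<delta> h) (N h) (c h) (idx h)"
    unfolding choice_iff by blast
  then have N: "0 < N h" and c: "i \<in> {1..N h} \<Longrightarrow> c h i \<in> closure B"
    and idx: "x \<in> B \<Longrightarrow> idx h x \<in> {1..N h}" "x \<in> B \<Longrightarrow> norm (x - c h (idx h x)) < \<delta> h"
    and loc: "AE x\<in>B in lebesgue. \<forall>\<^sub>F y in nhds x. idx h y = idx h x"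
    and sets: "{x\<in>B. idx h x = i} \<in> sets borel" for h i x
    unfolding ball_index_def by blast+
  define fh where "fh = (\<lambda>h x. G h (c h (idx h x)))"
  have c': "c h i \<in> \<Omega>" if "i \<in> {1..N h}" for h i using c[OF that] sub by (auto simp: B_def)
  have cx: "c h (idx h x) \<in> \<Omega>" if "x \<in> B" for h x using c'[OF idx(1)[OF that]] .
  have fh: "C2 (fh h x)" "strictly_convex (fh h x)" "0 \<le> fh h x \<xi>"
    "m' * wt (p - 2) \<xi> * (norm v)\<^sup>2 \<le> hess_form (fh h x) v \<xi>"
    "norm (\<chi> i j. partial j (partial i (fh h x)) \<xi>) \<le> M' * wt (q - 2) \<xi>" if "x \<in> B" for h x \<xi> v
    using G[OF cx[OF that], of h h] by (auto simp: fh_def admissible_def)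
  have upper: "fh h x \<xi> \<le> f x \<xi> + \<epsilon> h * K' * wt p \<xi>"
    and near: "norm \<xi> \<le> real h \<Longrightarrow> \<bar>fh h x \<xi> - f x \<xi>\<bar> \<le> \<epsilon> h * K' * wt p \<xi>" if "x \<in> B" for h x \<xi>
    using close[OF cx[OF that] _ idx(2)[OF that]] that B(4) unfolding fh_def approximates_def by blast+
  have unif: "uniform_limit (B \<times> C) (\<lambda>h (x, \<xi>). fh h x \<xi>) (\<lambda>(x, \<xi>). f x \<xi>) sequentially"
    if cptC: "compact C" for C :: "(real^'n) set"
    unfolding uniform_limit_iff
  proof (intro allI impI)
    fix e :: real assume e: "0 < e"
    obtain T where T: "\<And>\<xi>. \<xi> \<in> C \<Longrightarrow> norm \<xi> \<le> T"
      using compact_imp_bounded[OF cptC] by (auto simp: bounded_iff)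
    define Q where "Q = K' * (1 + T\<^sup>2) powr (p / 2)"
    \<comment> \<open>h > T brings C into the region of two-sided control, and h > Q / e makes the
      error there smaller than e.\<close>
    have "\<forall>\<^sub>F h in sequentially. max T (Q / e) < real h"
      using filterlim_real_sequentially unfolding filterlim_at_top_dense by blast
    then show "\<forall>\<^sub>F h in sequentially. \<forall>z\<in>B \<times> C. dist (case z of (x, \<xi>) \<Rightarrow> fh h x \<xi>) (case z of (x, \<xi>) \<Rightarrow> f x \<xi>) < e"
    proof eventually_elim
      case (elim h)
      have "Q < e * real h" using elim e by (simp add: field_simps)
      then have Qe: "\<epsilon> h * Q < e" using e by (simp add: \<epsilon>_def field_simps)
      have "dist (fh h x \<xi>) (f x \<xi>) < e" if "x \<in> B" "\<xi> \<in> C" for x \<xi>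
      proof -
        have "K' * wt p \<xi> \<le> Q"
          unfolding Q_def wt_def using pos assms(6) T[OF that(2)]
          by (intro mult_left_mono powr_mono2 add_left_mono power_mono) auto
        then have "\<epsilon> h * K' * wt p \<xi> \<le> \<epsilon> h * Q"
          using \<epsilon>(1)[of h] by (simp add: mult.assoc)
        moreover have "\<bar>fh h x \<xi> - f x \<xi>\<bar> \<le> \<epsilon> h * K' * wt p \<xi>"
          using elim T[OF that(2)] by (intro near that) auto
        ultimately show ?thesis using Qe by (simp add: dist_real_def)
      qed
      then show ?case by auto
    qed
  qed
  \<comment> \<open>The mixed derivatives vanish almost everywhere, so 1 merely stands for some
    positive constant.\<close>
  have h4: "H4 q 1 B (fh h)" for h
    unfolding H4_def using loc[of h]
  proof eventually_elim
    case (elim x)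
    show ?case
    proof (intro impI allI)
      fix \<xi> assume x: "x \<in> B"
      then have "\<forall>\<^sub>F y in nhds x. fh h y = fh h x"
        using elim by (auto elim!: eventually_mono simp: fh_def)
      from locally_constant_mixed_derivative[OF this fh(1)[OF x], of \<xi>]
      show "has_mixed_xi_x (fh h) x \<xi> \<and> norm (mixed_xi_x (fh h) x \<xi>) \<le> 1 * (1 + (norm \<xi>)\<^sup>2) powr ((q - 1) / 2)"
        by simp
    qed
  qed
  have int: "(\<forall>\<^sub>F k in sequentially. set_integrable lebesgue B (\<lambda>x. fh (id k) x (Du x))) \<and>
      (\<lambda>k. LINT x:B|lebesgue. fh (id k) x (Du x)) \<longlonglongrightarrow> (LINT x:B|lebesgue. f x (Du x))"
    if "W1p_with_gradient p B u Du" and f: "set_integrable lebesgue B (\<lambda>x. f x (Du x))" for u Du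
  proof -
    have Du: "in_Lp p B Du" using that by (simp add: W1p_with_gradient_def)
    have meas: "(\<lambda>x. indicator B x *\<^sub>R fh h x (Du x)) \<in> borel_measurable lebesgue" for h
      unfolding fh_def
    proof (rule measurable_piecewise_composition[where N = "N h" and g = "\<lambda>i. G h (c h i)"])
      show "set_borel_measurable lebesgue B Du" using Du by (simp add: in_Lp_def)
      show "continuous_on UNIV (G h (c h i))" if "i \<in> {1..N h}" for i
        using G[OF c'[OF that], of h] by (auto simp: C2_def admissible_def)
    qed (use idx sets in auto)
    \<comment> \<open>Pointwise convergence is the uniform one applied to the compact singleton of
      Du x.\<close>
    have lim: "(\<lambda>h. fh h x (Du x)) \<longlonglongrightarrow> f x (Du x)" if "x \<in> B" for x
      using tendsto_uniform_limitI[OF unif[of "{Du x}"], of "(x, Du x)"] that by simp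
    have dom: "fh h x (Du x) \<le> f x (Du x) + K' * wt p (Du x)" if "x \<in> B" for h x
    proof -
      have "\<epsilon> h * (K' * wt p (Du x)) \<le> 1 * (K' * wt p (Du x))"
        using \<epsilon>(2)[of h] pos wt_pos[of p "Du x"] by (intro mult_right_mono) auto
      then show ?thesis using upper[OF that, of h "Du x"] by (simp add: mult.assoc)
    qed
    note * = dominated_growth_convergence[where F = fh and f = f and D = Du, OF B(3) \<open>1 < p\<close> less_imp_le[OF pos(3)] Du f meas lim fh(3) dom]
    show ?thesis using *(1) *(2) by simp
  qed
  show "\<exists>fh :: nat \<Rightarrow> real^'n \<Rightarrow> real^'n \<Rightarrow> real.
       (\<forall>h. \<forall>x\<in>ball x\<^sub>0 R. \<forall>\<xi>. fh h x \<xi> \<ge> 0) \<and>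
       (\<forall>h. \<exists>N>0. \<exists>(a :: nat \<Rightarrow> real^'n \<Rightarrow> real) (g :: nat \<Rightarrow> real^'n \<Rightarrow> real).
          \<forall>x\<in>ball x\<^sub>0 R. \<forall>\<xi>. fh h x \<xi> = (\<Sum>i = 1..N. a i x * g i \<xi>)) \<and>
       (\<exists>m'>0. \<exists>M'>0. \<exists>K'>0. \<forall>h.
          H1 (ball x\<^sub>0 R) (fh h) \<and> H2 p m' (ball x\<^sub>0 R) (fh h) \<and>
          H3 q M' (ball x\<^sub>0 R) (fh h) \<and> H4 q K' (ball x\<^sub>0 R) (fh h)) \<and>
       (\<forall>h. \<forall>x\<in>ball x\<^sub>0 R. strictly_convex (fh h x)) \<and>
       (\<forall>C :: (real^'n) set. compact C \<longrightarrow>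
          uniform_limit (ball x\<^sub>0 R \<times> C) (\<lambda>h (x, \<xi>). fh h x \<xi>) (\<lambda>(x, \<xi>). f x \<xi>) sequentially) \<and>
       (\<exists>r :: nat \<Rightarrow> nat. strict_mono r \<and>
          (\<forall>u Du. W1p_with_gradient p (ball x\<^sub>0 R) u Du \<and>
                  set_integrable lebesgue (ball x\<^sub>0 R) (\<lambda>x. f x (Du x)) \<longrightarrow>
             (\<forall>\<^sub>F k in sequentially.
                set_integrable lebesgue (ball x\<^sub>0 R) (\<lambda>x. fh (r k) x (Du x))) \<and>
             (\<lambda>k. LINT x:ball x\<^sub>0 R|lebesgue. fh (r k) x (Du x))
               \<longlonglongrightarrow> (LINT x:ball x\<^sub>0 R|lebesgue. f x (Du x))))"
    unfolding B_def[symmetric]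
  proof (rule exI[of _ fh], intro conjI)
    show "\<forall>h. \<forall>x\<in>B. \<forall>\<xi>. 0 \<le> fh h x \<xi>" "\<forall>h. \<forall>x\<in>B. strictly_convex (fh h x)"
      using fh by blast+
    show "\<forall>h. \<exists>N>0. \<exists>(a :: nat \<Rightarrow> real^'n \<Rightarrow> real) (g :: nat \<Rightarrow> real^'n \<Rightarrow> real).
        \<forall>x\<in>B. \<forall>\<xi>. fh h x \<xi> = (\<Sum>i = 1..N. a i x * g i \<xi>)"
    proof (intro allI exI conjI ballI)
      fix h x \<xi> assume "x \<in> B"
      \<comment> \<open>The coefficients are the indicators of the pieces, so exactly one summand
        survives.\<close>
      then show "fh h x \<xi> = (\<Sum>i = 1..N h. (\<lambda>i x. if idx h x = i then 1 else 0) i x * (\<lambda>i \<xi>. G h (c h i) \<xi>) i \<xi>)"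
        using idx(1)[of x h] by (simp add: fh_def if_distrib[of "\<lambda>y. y * _"] cong: if_cong)
    qed (rule N)
    have "H1 B (fh h)" "H2 p m' B (fh h)" "H3 q M' B (fh h)" for h
      unfolding H1_def H2_def H3_def hessian_xi_def
      using fh unfolding hess_form_def wt_def by (auto intro!: AE_I2)
    then show "\<exists>m'>0. \<exists>M'>0. \<exists>K'>0. \<forall>h. H1 B (fh h) \<and> H2 p m' B (fh h) \<and> H3 q M' B (fh h) \<and> H4 q K' B (fh h)"
      using pos h4 zero_less_one by blast
    show "\<forall>C. compact C \<longrightarrow> uniform_limit (B \<times> C) (\<lambda>h (x, \<xi>). fh h x \<xi>) (\<lambda>(x, \<xi>). f x \<xi>) sequentially"
      using unif by blast
    show "\<exists>r :: nat \<Rightarrow> nat. strict_mono r \<and>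
          (\<forall>u Du. W1p_with_gradient p B u Du \<and> set_integrable lebesgue B (\<lambda>x. f x (Du x)) \<longrightarrow>
             (\<forall>\<^sub>F k in sequentially. set_integrable lebesgue B (\<lambda>x. fh (r k) x (Du x))) \<and>
             (\<lambda>k. LINT x:B|lebesgue. fh (r k) x (Du x)) \<longlonglongrightarrow> (LINT x:B|lebesgue. f x (Du x)))"
      by (rule exI[of _ id], intro conjI allI impI int[THEN conjunct1] int[THEN conjunct2])
        (auto simp: strict_mono_def)
  qed
qed

end
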